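(* Let $f(z)=\sum_{k=0}^n a_k z^k\in\mathbb{C}[z]$ be a polynomial of degree $n\ge 1$ with $f(0)=a_0\neq 0$. Then $$\mathcal{D}[f]\le \sqrt{2}\,\sqrt{\mathcal{H}[f]}.$$ Moreover the inequality is sharp: for every constant $c<\sqrt{2}$ there is a polynomial $f\in\mathbb{C}[z]$ with $f(0)\ne 0$ such that $\mathcal{D}[f]> c\sqrt{\mathcal{H}[f]}$.
   Context: Write the roots of $f$ (with multiplicity) as $r_je^{2\pi i\theta_j}$, $1\le j\le n$, with $r_j>0$ and $\theta_j\in\mathbb{T}=\mathbb{R}/\mathbb{Z}$. For $\alpha\le\beta<\alpha+1$, $N_f(\alpha,\beta)$ denotes the number of $j$ with $\theta_j$ lying in the arc $[\alpha,\beta]$ of $\mathbb{T}$. The discrepancy is $\mathcal{D}[f]=\max_{\alpha\le\beta<\alpha+1}\big(\frac{N_f(\alpha,\beta)}{n}-(\beta-\alpha)\big)$ and the height is $\mathcal{H}[f]=\frac1n\log\frac{\max_{|z|=1}|f(z)|}{\sqrt{|a_0a_n|}}$. *)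

theory Defs
  imports "HOL-Analysis.Analysis" "HOL-Computational_Algebra.Polynomial"
begin

text \<open>Angle of a nonzero complex number z = r e^{2 pi i theta}, as a real representative
  of theta in R/Z (taken in (-1/2, 1/2]).\<close>
definition angle_frac :: "complex \<Rightarrow> real" where
  "angle_frac z = Arg z / (2 * pi)"

text \<open>theta lies on the arc [alpha, beta] of R/Z (alpha \<le> beta < alpha + 1) iff
  the fractional part of theta - alpha is at most beta - alpha.\<close>
definition on_arc :: "real \<Rightarrow> real \<Rightarrow> real \<Rightarrow> bool" where
  "on_arc \<alpha> \<beta> \<theta> \<longleftrightarrow> frac (\<theta> - \<alpha>) \<le> \<beta> - \<alpha>"

definition root_count :: "complex poly \<Rightarrow> real \<Rightarrow> real \<Rightarrow> nat" where
  "root_count f \<alpha> \<beta> =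
     (\<Sum>z\<in>{z. poly f z = 0 \<and> on_arc \<alpha> \<beta> (angle_frac z)}. order z f)"

definition discrepancy :: "complex poly \<Rightarrow> real" where
  "discrepancy f = Sup {real (root_count f \<alpha> \<beta>) / real (degree f) - (\<beta> - \<alpha>) | \<alpha> \<beta>.
                        \<alpha> \<le> \<beta> \<and> \<beta> < \<alpha> + 1}"

definition height :: "complex poly \<Rightarrow> real" where
  "height f = (1 / real (degree f)) *
     ln (Sup ((\<lambda>z. norm (poly f z)) ` sphere 0 1) / sqrt (norm (coeff f 0 * lead_coeff f)))"

end

theory Submission
  imports Defs "HOL-Complex_Analysis.Complex_Analysis" "HOL-Real_Asymp.Real_Asymp"
    "HOL-Computational_Algebra.Fundamental_Theorem_Algebra"
begin

text \<open>
  Moving the roots radially to the unit circle only decreases the height, so let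
  \<open>\<mu>\<close> be the normalised counting measure of \<open>n\<close> points on the circle and \<open>h\<close> the
  maximum of its logarithmic potential. For every probability measure \<open>\<nu>\<close> on the circle with
  potential \<open>U\<close>, Fubini gives \<open>\<integral> U d\<mu> \<le> h\<close>; hence \<open>U \<ge> A 1\<^sub>I + b\<close> on the circle implies
  \<open>A \<mu>(I) + b \<le> h\<close>. Measures are encoded by holomorphic \<open>F\<close> on the unit disc with
  \<open>F 0 = 0\<close> and \<open>Re (1 - 2 z F' z) \<ge> 0\<close>, the density being \<open>Re (1 - 2 z F')\<close> and \<open>U = Re F\<close>.
  For an arc \<open>I\<close> of length \<open>l\<close> with \<open>\<mu>(I) = l + d\<close> two choices of \<open>\<nu>\<close> suffice for
  \<open>h \<ge> d\<^sup>2/2\<close>. If \<open>l \<le> 3d/4\<close>, take the equilibrium measure of an arc complementary to a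
  neighbourhood of \<open>I\<close>. If \<open>l \<ge> 3d/4\<close>, take \<open>U = A (1\<^sub>J * K - |J|)\<close>, where \<open>J\<close> is \<open>I\<close>
  enlarged by \<open>d/4\<close> on both sides and the kernel \<open>K\<close>, supported in \<open>[-d/4, d/4]\<close>, is the
  real part of a conformal map of the disc onto a half disc.

  The constant is attained asymptotically by \<open>(z - 1)^m\<close> times the polynomial of \<open>z = e\<^sup>2\<^sup>i\<^sup>t\<close>
  that represents the Gegenbauer polynomial \<open>C\<^sub>N\<^sup>m(cos t)\<close>, for \<open>N \<gg> m \<gg> \<surd>(N log N)\<close>: the function
  \<open>sin\<^sup>m t C\<^sub>N\<^sup>m(cos t)\<close> satisfies \<open>y'' = - Q y\<close>, and an energy argument bounds it by
  its value at \<open>\<pi>/2\<close>, up to a factor linear in \<open>N + m\<close>.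
\<close>

section \<open>Duality with measures on the circle\<close>

text \<open>The factor \<open>w / (w - a)\<close> is the Cauchy kernel with
  \<open>dw = i w dt\<close> absorbed, so that from here on all integrals run over the
  angle.\<close>

lemma Cauchy_integral_cis:
  fixes g :: "complex \<Rightarrow> complex"
  assumes "g holomorphic_on ball 0 1" "0 < \<rho>" "\<rho> < 1" "norm a < \<rho>"
  shows "((\<lambda>t. g (of_real \<rho> * cis t) * (of_real \<rho> * cis t / (of_real \<rho> * cis t - a)))
           has_integral 2 * pi * g a) {0..2*pi}"
proof -
  have "((\<lambda>u. g u / (u - a)) has_contour_integral (2 * of_real pi * \<i> * g a)) (circlepath 0 \<rho>)"
    by (rule Cauchy_integral_circlepath_simple)
       (use assms in \<open>auto intro!: holomorphic_on_subset[OF assms(1)]\<close>)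
  then have "((\<lambda>t. g (of_real \<rho> * cis t) / (of_real \<rho> * cis t - a) * \<rho> * \<i> * cis t)
      has_integral (2 * of_real pi * \<i> * g a)) {0..2*pi}"
    by (simp add: circlepath_def has_contour_integral_part_circlepath_iff)
  from has_integral_mult_right[OF this, of "-\<i>"] show ?thesis
    by (simp add: mult_ac)
qed

lemma mean_value_cis:
  fixes g :: "complex \<Rightarrow> complex"
  assumes "g holomorphic_on ball 0 1" "0 < \<rho>" "\<rho> < 1"
  shows "((\<lambda>t. g (of_real \<rho> * cis t)) has_integral 2 * pi * g 0) {0..2*pi}"
  using Cauchy_integral_cis[OF assms, of 0] assms by simp

text \<open>The potential at \<open>\<rho>\<^sup>2 \<zeta>\<close> of the measure with density \<open>Re (1 - 2 z F')\<close> on the circle of radius \<open>\<rho>\<close>: with a holomorphic logarithm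
  \<open>L\<close> of \<open>1 - z cnj \<zeta>\<close>, integration by parts turns the mean of \<open>L cnj (z F')\<close> into a Cauchy integral.\<close>

lemma ln_norm_mean_identity:
  assumes F: "F holomorphic_on ball 0 1" "F 0 = 0"
    and \<rho>: "0 < \<rho>" "\<rho> < 1" and \<zeta>: "norm \<zeta> = 1"
  shows "((\<lambda>t. let w = of_real \<rho> * cis t in ln (norm (w - \<zeta>)) * (1 - 2 * Re (w * deriv F w)))
            has_integral 2 * pi * Re (F (of_real (\<rho>\<^sup>2) * \<zeta>))) {0..2*pi}"
proof -
  define w where "w t = of_real \<rho> * cis t" for t
  define L where "L z = Ln (1 - cnj \<zeta> * z)" for z
  define L' where "L' z = 1 / (z - \<zeta>)" for z
  have wb: "w t \<in> ball 0 1" and nw: "norm (w t) = \<rho>" for t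
    using \<rho> by (auto simp: w_def norm_mult)
  have \<zeta>\<zeta>: "\<zeta> * cnj \<zeta> = 1" using \<zeta> by (simp add: complex_norm_square[symmetric])
  have \<zeta>\<zeta>': "cnj \<zeta> * \<zeta> = 1" using \<zeta>\<zeta> by (simp add: mult.commute)
  have L_dom: "1 - cnj \<zeta> * z \<notin> \<real>\<^sub>\<le>\<^sub>0" "1 - cnj \<zeta> * z \<noteq> 0" if "z \<in> ball 0 1" for z
  proof -
    have "norm (cnj \<zeta> * z) < 1" using that \<zeta> by (simp add: norm_mult)
    then have "Re (cnj \<zeta> * z) < 1" using complex_Re_le_cmod[of "cnj \<zeta> * z"] by linarith
    then show "1 - cnj \<zeta> * z \<notin> \<real>\<^sub>\<le>\<^sub>0"
      by (auto simp: complex_nonpos_Reals_iff)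
    then show "1 - cnj \<zeta> * z \<noteq> 0" by auto
  qed
  have dL: "(L has_field_derivative L' z) (at z)" if "z \<in> ball 0 1" for z
  proof -
    have "(L has_field_derivative (- cnj \<zeta> / (1 - cnj \<zeta> * z))) (at z)"
      unfolding L_def using L_dom[OF that] by (auto intro!: derivative_eq_intros simp: field_simps)
    moreover have "- cnj \<zeta> / (1 - cnj \<zeta> * z) = L' z"
    proof -
      have "z \<noteq> \<zeta>" using that \<zeta> by auto
      moreover have "- cnj \<zeta> * (z - \<zeta>) = 1 - cnj \<zeta> * z" using \<zeta>\<zeta>' by (simp add: algebra_simps)
      ultimately show ?thesis using L_dom(2)[OF that] unfolding L'_def by (simp add: field_simps)
    qed
    ultimately show ?thesis by simp
  qed
  have holL: "L holomorphic_on ball 0 1"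
    using dL by (subst holomorphic_on_open) blast+
  have holF': "deriv F holomorphic_on ball 0 1"
    by (intro holomorphic_deriv F) auto
  have dF: "(F has_field_derivative deriv F z) (at z)" if "z \<in> ball 0 1" for z
    using F(1) that by (simp add: holomorphic_derivI)
  have L0: "L 0 = 0" by (simp add: L_def)
  have ReL: "Re (L z) = ln (norm (z - \<zeta>))" if "z \<in> ball 0 1" for z
  proof -
    have "norm (1 - cnj \<zeta> * z) = norm (\<zeta> * (1 - cnj \<zeta> * z))" using \<zeta> by (simp add: norm_mult)
    also have "\<zeta> * (1 - cnj \<zeta> * z) = \<zeta> - z" using \<zeta>\<zeta> by algebra
    finally show ?thesis using L_dom(2)[OF that] by (simp add: L_def norm_minus_commute)
  qed
  have i1: "((\<lambda>t. L (w t)) has_integral 0) {0..2*pi}"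
    using mean_value_cis[OF holL \<rho>] by (simp add: w_def L0)
  have "(\<lambda>z. L z * (z * deriv F z)) holomorphic_on ball 0 1"
    by (intro holomorphic_intros holL holF')
  from mean_value_cis[OF this \<rho>]
  have i2: "((\<lambda>t. L (w t) * (w t * deriv F (w t))) has_integral 0) {0..2*pi}"
    by (simp add: w_def)
  have dw: "(w has_vector_derivative \<i> * w t) (at t within S)" for t S
    unfolding w_def has_vector_derivative_def
    by (auto intro!: derivative_eq_intros simp: algebra_simps scaleR_conv_of_real)
  have per: "w (2*pi) = w 0" by (simp add: w_def)
  have d1: "((\<lambda>t. L (w t)) has_vector_derivative (\<i> * w t * L' (w t))) (at t within S)" for t S
    using field_vector_diff_chain_within[OF dw[of t S], of L "L' (w t)"] dL[OF wb]
    by (simp add: has_field_derivative_at_within o_def)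
  have d2: "((\<lambda>t. F (w t)) has_vector_derivative (\<i> * w t * deriv F (w t))) (at t within S)" for t S
    using field_vector_diff_chain_within[OF dw[of t S], of F "deriv F (w t)"] dF[OF wb]
    by (simp add: has_field_derivative_at_within o_def)
  have d3: "((\<lambda>t. cnj (F (w t))) has_vector_derivative cnj (\<i> * w t * deriv F (w t))) (at t within S)" for t S
    using bounded_linear.has_vector_derivative[OF bounded_linear_cnj d2] .
  \<comment> \<open>Integration by parts along the closed circle moves the derivative from
    \<open>cnj F\<close> to \<open>L\<close>; the boundary terms cancel because \<open>w\<close> is
    periodic.\<close>
  have "((\<lambda>t. L (w t) * cnj (\<i> * w t * deriv F (w t)) + \<i> * w t * L' (w t) * cnj (F (w t)))
     has_integral (L (w (2*pi)) * cnj (F (w (2*pi))) - L (w 0) * cnj (F (w 0)))) {0..2*pi}"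
    by (intro fundamental_theorem_of_calculus has_vector_derivative_mult[OF d1 d3]) auto
  from has_integral_mult_right[OF this[unfolded per diff_self], of "\<i>"]
  have i3: "((\<lambda>t. L (w t) * cnj (w t * deriv F (w t)) - w t * L' (w t) * cnj (F (w t)))
     has_integral 0) {0..2*pi}"
    by (simp add: algebra_simps)
  have \<rho>\<zeta>: "norm (of_real (\<rho>\<^sup>2) * \<zeta>) < \<rho>"
    using \<rho> \<zeta> by (simp add: norm_mult power2_eq_square)
  have "((\<lambda>t. F (w t) * (w t / (w t - of_real (\<rho>\<^sup>2) * \<zeta>)) - F (w t)) has_integral
      (2 * pi * F (of_real (\<rho>\<^sup>2) * \<zeta>) - 2 * pi * F 0)) {0..2*pi}"
    unfolding w_def
    by (intro has_integral_diff Cauchy_integral_cis mean_value_cis F \<rho> \<rho>\<zeta>)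
  \<comment> \<open>Reflection in the circle of radius \<rho>: there
    \<open>cnj w = \<rho>\<^sup>2 / w\<close>, so conjugation turns the kernel with its pole at
    \<zeta> outside the circle into one with its pole at \<open>\<rho>\<^sup>2 * \<zeta>\<close>
    inside, where Cauchy's formula applies.\<close>
  moreover have "F (w t) * (w t / (w t - of_real (\<rho>\<^sup>2) * \<zeta>)) - F (w t) = - (cnj (w t * L' (w t)) * F (w t))" for t
  proof -
    have ww: "w t * cnj (w t) = of_real (\<rho>\<^sup>2)" using nw[of t] by (simp add: complex_norm_square[symmetric])
    have n1: "w t \<noteq> \<zeta>" using nw[of t] \<zeta> \<rho> by auto
    then have n1': "cnj (w t) - cnj \<zeta> \<noteq> 0" by (simp flip: complex_cnj_diff)
    have n2: "w t - of_real (\<rho>\<^sup>2) * \<zeta> \<noteq> 0" using \<rho>\<zeta> nw[of t] by auto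
    have "(of_real (\<rho>\<^sup>2) * \<zeta>) * (cnj (w t) - cnj \<zeta>) = - cnj (w t) * (w t - of_real (\<rho>\<^sup>2) * \<zeta>)"
      using \<zeta>\<zeta> ww by (simp add: algebra_simps)
    then have "of_real (\<rho>\<^sup>2) * \<zeta> / (w t - of_real (\<rho>\<^sup>2) * \<zeta>) = - (cnj (w t) / (cnj (w t) - cnj \<zeta>))"
      using n1' n2 by (simp add: field_simps)
    moreover have "w t / (w t - of_real (\<rho>\<^sup>2) * \<zeta>) = 1 + of_real (\<rho>\<^sup>2) * \<zeta> / (w t - of_real (\<rho>\<^sup>2) * \<zeta>)"
      using n2 by (simp add: field_simps)
    ultimately have e: "w t / (w t - of_real (\<rho>\<^sup>2) * \<zeta>) = 1 - cnj (w t * L' (w t))"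
      by (simp add: L'_def)
    show ?thesis unfolding e by (simp add: right_diff_distrib mult.commute)
  qed
  ultimately have "((\<lambda>t. - (cnj (w t * L' (w t)) * F (w t))) has_integral
      (2 * pi * F (of_real (\<rho>\<^sup>2) * \<zeta>))) {0..2*pi}" using F(2) by simp
  from has_integral_neg[OF has_integral_linear[OF this bounded_linear_cnj]]
  have i4: "((\<lambda>t. w t * L' (w t) * cnj (F (w t))) has_integral
      - (2 * pi * cnj (F (of_real (\<rho>\<^sup>2) * \<zeta>)))) {0..2*pi}"
    by (simp add: o_def)
  \<comment> \<open>The last two groups of terms combine to \<open>- L * cnj (w F')\<close>, so
    \<open>X = L * (1 - 2 Re (w F'))\<close> with a real second factor. Among the four integrals
    only \<open>i4\<close> is nonzero.\<close>
  define X where "X t = L (w t) - L (w t) * (w t * deriv F (w t)) -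
        (L (w t) * cnj (w t * deriv F (w t)) - w t * L' (w t) * cnj (F (w t))) - w t * L' (w t) * cnj (F (w t))" for t
  have "(X has_integral 0 - 0 - 0 - (- (2 * pi * cnj (F (of_real (\<rho>\<^sup>2) * \<zeta>))))) {0..2*pi}"
    unfolding X_def by (intro has_integral_diff i1 i2 i3 i4)
  from has_integral_linear[OF this bounded_linear_Re]
  have "((\<lambda>t. Re (X t)) has_integral 2 * pi * Re (F (of_real (\<rho>\<^sup>2) * \<zeta>))) {0..2*pi}"
    by (simp add: o_def)
  moreover have "Re (X t) = ln (norm (w t - \<zeta>)) * (1 - 2 * Re (w t * deriv F (w t)))" for t
  proof -
    have e: "X t = L (w t) - L (w t) * (w t * deriv F (w t)) - L (w t) * cnj (w t * deriv F (w t))"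
      by (simp add: X_def)
    show ?thesis unfolding e ReL[OF wb, symmetric] by (simp add: algebra_simps)
  qed
  ultimately show ?thesis unfolding w_def Let_def by (simp only:)
qed

text \<open>The logarithm of the product is integrated over the circle of radius
  \<open>sqrt r\<close> against the density \<open>1 - 2 Re (w F')\<close>, which is nonnegative of
  total mass 2 pi; \<open>ln_norm_mean_identity\<close> evaluates each term. For
  \<open>r = 0\<close> the product at 0 is 1, which gives \<open>ln M >= 0\<close>.\<close>

lemma ln_potential_bound:
  assumes F: "F holomorphic_on ball 0 1" "F 0 = 0"
    and pos: "\<And>z. z \<in> ball 0 1 \<Longrightarrow> Re (z * deriv F z) \<le> 1/2"
    and Z: "finite Z" "\<And>x. x \<in> Z \<Longrightarrow> norm (\<zeta> x) = 1"
    and M: "\<And>w. norm w < 1 \<Longrightarrow> (\<Prod>x\<in>Z. norm (w - \<zeta> x) ^ k x) \<le> M"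
    and r: "0 \<le> r" "r < 1"
  shows "(\<Sum>x\<in>Z. real (k x) * Re (F (of_real r * \<zeta> x))) \<le> ln M"
proof (cases "r = 0")
  case True
  have "(\<Prod>x\<in>Z. norm (0 - \<zeta> x) ^ k x) = 1" using Z by simp
  then have "1 \<le> M" using M[of 0] by simp
  then show ?thesis using True F by simp
next
  case False
  define \<rho> where "\<rho> = sqrt r"
  have \<rho>: "0 < \<rho>" "\<rho> < 1" "\<rho>\<^sup>2 = r" using r False by (auto simp: \<rho>_def)
  define w where "w t = of_real \<rho> * cis t" for t
  define P where "P t = 1 - 2 * Re (w t * deriv F (w t))" for t
  have nw: "norm (w t) < 1" for t using \<rho> by (auto simp: w_def norm_mult)
  have P: "P t \<ge> 0" for t using pos[of "w t"] nw[of t] by (simp add: P_def)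
  have holF': "(\<lambda>z. 1 - 2 * (z * deriv F z)) holomorphic_on ball 0 1"
    by (intro holomorphic_intros holomorphic_deriv F) auto
  from has_integral_linear[OF mean_value_cis[OF this \<rho>(1,2)] bounded_linear_Re]
  have "(P has_integral 2*pi) {0..2*pi}"
    unfolding P_def w_def by (simp add: o_def)
  then have I1: "((\<lambda>t. ln M * P t) has_integral ln M * (2*pi)) {0..2*pi}"
    by (rule has_integral_mult_right)
  have I2: "((\<lambda>t. \<Sum>x\<in>Z. real (k x) * (ln (norm (w t - \<zeta> x)) * P t)) has_integral
      (\<Sum>x\<in>Z. real (k x) * (2 * pi * Re (F (of_real r * \<zeta> x))))) {0..2*pi}"
    using ln_norm_mean_identity[OF F \<rho>(1,2) Z(2)]
    by (intro has_integral_sum has_integral_mult_right Z(1)) (simp_all add: Let_def w_def P_def \<rho>(3))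
  have "(\<Sum>x\<in>Z. real (k x) * (2 * pi * Re (F (of_real r * \<zeta> x)))) \<le> ln M * (2*pi)"
  proof (rule has_integral_le[OF I2 I1])
    fix t :: real
    have "w t \<noteq> \<zeta> x" if "x \<in> Z" for x using nw[of t] Z(2)[OF that] by auto
    then have pos': "norm (w t - \<zeta> x) > 0" if "x \<in> Z" for x using that by simp
    have "(\<Sum>x\<in>Z. real (k x) * ln (norm (w t - \<zeta> x))) = ln (\<Prod>x\<in>Z. norm (w t - \<zeta> x) ^ k x)"
      using pos' by (subst ln_prod) (auto simp: Z ln_realpow intro!: sum.cong)
    also have "\<dots> \<le> ln M"
    proof (subst ln_le_cancel_iff)
      show "0 < (\<Prod>x\<in>Z. norm (w t - \<zeta> x) ^ k x)" by (intro prod_pos) (use pos' in auto)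
      then show "0 < M" using M[OF nw[of t]] by linarith
    qed (use M[OF nw[of t]] in auto)
    finally have "(\<Sum>x\<in>Z. real (k x) * ln (norm (w t - \<zeta> x))) * P t \<le> ln M * P t"
      using P by (intro mult_right_mono)
    then show "(\<Sum>x\<in>Z. real (k x) * (ln (norm (w t - \<zeta> x)) * P t)) \<le> ln M * P t"
      by (simp add: sum_distrib_right mult.assoc)
  qed
  also have "(\<Sum>x\<in>Z. real (k x) * (2 * pi * Re (F (of_real r * \<zeta> x))))
      = (\<Sum>x\<in>Z. real (k x) * Re (F (of_real r * \<zeta> x))) * (2 * pi)"
    by (simp add: sum_distrib_left sum_distrib_right mult_ac)
  finally show ?thesis by simp
qed

section \<open>The square root with a cut along an arc\<close>

lemma continuous_on_csqrt_Re_nonneg: "continuous_on {z. Re z \<ge> 0} csqrt"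
proof (clarsimp simp: continuous_on_eq_continuous_within)
  fix z :: complex assume z: "0 \<le> Re z"
  show "continuous (at z within {z. 0 \<le> Re z}) csqrt"
  proof (cases "z = 0")
    case False
    then have "z \<notin> \<real>\<^sub>\<le>\<^sub>0" using z by (auto simp: complex_nonpos_Reals_iff complex_eq_iff)
    then show ?thesis by (simp add: continuous_at_imp_continuous_at_within continuous_at_csqrt)
  next
    case True
    have "((\<lambda>x. sqrt (norm x)) \<longlongrightarrow> sqrt (norm (0::complex))) (at 0 within {z. 0 \<le> Re z})"
      by (intro tendsto_intros)
    then have "(csqrt \<longlongrightarrow> 0) (at 0 within {z. 0 \<le> Re z})"
      by (subst tendsto_norm_zero_iff[symmetric]) simp
    then show ?thesis using True by (simp add: continuous_within)
  qed
qed

text \<open>A branch of \<open>\<surd>(1 - 2 z cos \<phi> + z\<^sup>2)\<close> that is continuous on the closed disc.\<close>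

definition gap_sqrt :: "real \<Rightarrow> complex \<Rightarrow> complex" where
  "gap_sqrt \<phi> z = csqrt (1 - z * cis \<phi>) * csqrt (1 - z * cis (- \<phi>))"

lemma Re_one_minus_mult_cis:
  assumes "norm z \<le> 1" shows "Re (1 - z * cis \<phi>) \<ge> 0"
proof -
  have "norm (z * cis \<phi>) \<le> 1" using assms by (simp add: norm_mult)
  then show ?thesis using complex_Re_le_cmod[of "z * cis \<phi>"] by simp
qed

lemma Re_one_minus_mult_cis_pos:
  assumes "norm z < 1" shows "Re (1 - z * cis \<phi>) > 0"
proof -
  have "norm (z * cis \<phi>) < 1" using assms by (simp add: norm_mult)
  then show ?thesis using complex_Re_le_cmod[of "z * cis \<phi>"] by simp
qed

lemma gap_sqrt_0 [simp]: "gap_sqrt \<phi> 0 = 1"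
  by (simp add: gap_sqrt_def)

lemma continuous_on_gap_sqrt: "continuous_on (cball 0 1) (gap_sqrt \<phi>)"
  unfolding gap_sqrt_def
  by (intro continuous_intros continuous_on_compose2[OF continuous_on_csqrt_Re_nonneg])
     (use Re_one_minus_mult_cis[of _ \<phi>] Re_one_minus_mult_cis[of _ "- \<phi>"] in auto)

lemma holomorphic_on_gap_sqrt: "gap_sqrt \<phi> holomorphic_on ball 0 1"
proof -
  have "1 - z * cis \<phi> \<notin> \<real>\<^sub>\<le>\<^sub>0" if "norm z < 1" for z \<phi>
    using Re_one_minus_mult_cis_pos[OF that, of \<phi>] by (auto simp: complex_nonpos_Reals_iff)
  then show ?thesis unfolding gap_sqrt_def by (intro holomorphic_intros) auto
qed

lemma gap_sqrt_power2:
  "(gap_sqrt \<phi> z)\<^sup>2 = 1 - 2 * of_real (cos \<phi>) * z + z\<^sup>2"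
proof -
  have "(gap_sqrt \<phi> z)\<^sup>2 = (1 - z * cis \<phi>) * (1 - z * cis (- \<phi>))"
    by (simp add: gap_sqrt_def power_mult_distrib)
  also have "\<dots> = 1 - z * (cis \<phi> + cis (- \<phi>)) + z\<^sup>2 * (cis \<phi> * cis (- \<phi>))"
    by (simp add: algebra_simps power2_eq_square)
  also have "cis \<phi> + cis (- \<phi>) = 2 * of_real (cos \<phi>)" by (simp add: complex_eq_iff)
  also have "cis \<phi> * cis (- \<phi>) = 1" by (simp add: cis_mult)
  finally show ?thesis by (simp add: algebra_simps)
qed

lemma gap_sqrt_power2':
  "(gap_sqrt \<phi> z)\<^sup>2 = (of_real (cos (\<phi>/2)))\<^sup>2 * (1 - z)\<^sup>2 + (of_real (sin (\<phi>/2)))\<^sup>2 * (1 + z)\<^sup>2"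
proof -
  define x :: complex where "x = (of_real (cos (\<phi>/2)))\<^sup>2"
  have s: "(of_real (sin (\<phi>/2)))\<^sup>2 = 1 - x"
    unfolding x_def of_real_power[symmetric] sin_squared_eq by simp
  have "cos \<phi> = 2 * (cos (\<phi>/2))\<^sup>2 - 1" using cos_double_cos[of "\<phi>/2"] by simp
  then have c: "of_real (cos \<phi>) = 2 * x - 1" by (simp add: x_def)
  show ?thesis
    unfolding gap_sqrt_power2 s c x_def[symmetric] by (simp add: algebra_simps power2_eq_square)
qed

lemma gap_sqrt_nonzero:
  assumes "norm z < 1" shows "gap_sqrt \<phi> z \<noteq> 0"
  using Re_one_minus_mult_cis_pos[OF assms, of \<phi>] Re_one_minus_mult_cis_pos[OF assms, of "-\<phi>"]
  by (auto simp: gap_sqrt_def simp del: minus_complex.simps)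

text \<open>By connectedness the real part cannot change sign; this selects the branch of a square
  root from its value at one point.\<close>

lemma Re_nonzero_sign_const:
  fixes g :: "complex \<Rightarrow> complex"
  assumes "continuous_on S g" "connected S" "\<And>z. z \<in> S \<Longrightarrow> Re (g z) \<noteq> 0" "a \<in> S" "Re (g a) > 0" "z \<in> S"
  shows "Re (g z) > 0"
proof (rule ccontr)
  assume "\<not> Re (g z) > 0"
  moreover have "connected ((\<lambda>z. Re (g z)) ` S)"
    by (intro connected_continuous_image continuous_intros assms)
  then have "is_interval ((\<lambda>z. Re (g z)) ` S)" by (simp add: is_interval_connected_1)
  ultimately have "0 \<in> (\<lambda>z. Re (g z)) ` S"
    using assms(4-6) unfolding is_interval_1 by (meson imageI less_imp_le not_less)
  then show False using assms(3) by force
qed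

lemma Re_moebius_pos:
  assumes "norm z < 1" shows "Re ((1 + z) / (1 - z)) > 0" "Re ((1 - z) / (1 + z)) > 0"
proof -
  have *: "Re ((1 + z) / (1 - z)) > 0" if "norm z < 1" for z
  proof -
    have "z \<noteq> 1" using that by auto
    have "(norm z)\<^sup>2 < 1" using that by (simp add: power_less_one_iff)
    then have "1 - (Re z)\<^sup>2 - (Im z)\<^sup>2 > 0" by (simp add: cmod_power2)
    then have "(1 + Re z) * (1 - Re z) - Im z * Im z > 0" by (simp add: algebra_simps power2_eq_square)
    moreover have "(1 - Re z)\<^sup>2 + (Im z)\<^sup>2 > 0"
      using \<open>z \<noteq> 1\<close> by (auto simp: complex_eq_iff sum_power2_gt_zero_iff)
    ultimately show ?thesis by (simp add: Re_divide)
  qed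
  show "Re ((1 + z) / (1 - z)) > 0" using * assms by blast
  show "Re ((1 - z) / (1 + z)) > 0" using *[of "-z"] assms by simp
qed

text \<open>An imaginary \<open>g\<close> would have a real square that is at most 0. Then
  \<open>X\<^sup>2\<close> is real, and \<open>Re X > 0\<close> makes \<open>X\<close> itself real,
  so the right-hand side is positive, a contradiction.\<close>

lemma Re_nonzero_if_power2:
  fixes g X :: complex
  assumes "g\<^sup>2 = of_real a + of_real b * X\<^sup>2" "a \<ge> 0" "b > 0" "Re X > 0"
  shows "Re g \<noteq> 0"
proof
  assume "Re g = 0"
  then have "Im (g\<^sup>2) = 0" and 1: "Re (g\<^sup>2) \<le> 0" by (simp_all add: power2_eq_square)
  then have "b * (2 * (Re X * Im X)) = 0"
    using arg_cong[OF assms(1), of Im] by (auto simp: power2_eq_square[of X])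
  then have "Im X = 0" using assms by simp
  then have "Re (g\<^sup>2) = a + b * (Re X)\<^sup>2" using assms(1) by (simp add: power2_eq_square[of X] power2_eq_square[of "Re X"])
  moreover have "b * (Re X)\<^sup>2 > 0" using assms by simp
  ultimately show False using 1 assms by linarith
qed

text \<open>By \<open>gap_sqrt_power2'\<close> the square of the first quotient is
  \<open>cos\<^sup>2 (\<phi>/2) + sin\<^sup>2 (\<phi>/2) ((1 + z) / (1 - z))\<^sup>2\<close>, and
  similarly for the second. The Moebius term lies in the right half plane, so the quotients avoid
  the imaginary axis and keep the sign of their value 1 at the origin.\<close>

lemma Re_gap_sqrt_divide_pos:
  assumes "0 < \<phi>" "\<phi> < pi" "norm z < 1"
  shows "Re (gap_sqrt \<phi> z / (1 - z)) > 0" "Re (gap_sqrt \<phi> z / (1 + z)) > 0"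
proof -
  have c: "cos (\<phi>/2) > 0" and s: "sin (\<phi>/2) > 0"
    using assms by (auto intro!: cos_gt_zero_pi sin_gt_zero)
  have nz: "1 - z \<noteq> 0" "1 + z \<noteq> 0" if "norm z < 1" for z :: complex
    using that by (auto simp: add_eq_0_iff)
  have cont: "continuous_on (ball 0 1) (gap_sqrt \<phi>)"
    by (rule continuous_on_subset[OF continuous_on_gap_sqrt]) auto
  show "Re (gap_sqrt \<phi> z / (1 - z)) > 0"
  proof (rule Re_nonzero_sign_const[where S = "ball 0 1" and a = 0 and g = "\<lambda>z. gap_sqrt \<phi> z / (1 - z)"])
    fix z :: complex assume z: "z \<in> ball 0 1"
    have "(gap_sqrt \<phi> z / (1 - z))\<^sup>2 = of_real ((cos (\<phi>/2))\<^sup>2) + of_real ((sin (\<phi>/2))\<^sup>2) * ((1 + z) / (1 - z))\<^sup>2"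
      unfolding power_divide gap_sqrt_power2' using nz(1)[of z] z by (subst add_divide_distrib) simp
    then show "Re (gap_sqrt \<phi> z / (1 - z)) \<noteq> 0"
      by (rule Re_nonzero_if_power2) (use z c s Re_moebius_pos in auto)
  qed (use nz assms in \<open>auto intro!: continuous_intros cont\<close>)
  show "Re (gap_sqrt \<phi> z / (1 + z)) > 0"
  proof (rule Re_nonzero_sign_const[where S = "ball 0 1" and a = 0 and g = "\<lambda>z. gap_sqrt \<phi> z / (1 + z)"])
    fix z :: complex assume z: "z \<in> ball 0 1"
    have "(gap_sqrt \<phi> z / (1 + z))\<^sup>2 = of_real ((sin (\<phi>/2))\<^sup>2) + of_real ((cos (\<phi>/2))\<^sup>2) * ((1 - z) / (1 + z))\<^sup>2"
      unfolding power_divide gap_sqrt_power2' using nz(2)[of z] z by (subst add_divide_distrib) simp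
    then show "Re (gap_sqrt \<phi> z / (1 + z)) \<noteq> 0"
      by (rule Re_nonzero_if_power2) (use z c s Re_moebius_pos in auto)
  qed (use nz assms in \<open>auto intro!: continuous_intros cont\<close>)
qed

section \<open>The equilibrium measure of an arc\<close>

lemma tendsto_radial:
  fixes g :: "complex \<Rightarrow> complex"
  assumes "continuous_on (cball 0 1) g" "norm z = 1"
  shows "((\<lambda>r. g (of_real r * z)) \<longlongrightarrow> g z) (at_left (1::real))"
proof -
  have "continuous_on {-1..1} (\<lambda>r::real. g (of_real r * z))"
    by (intro continuous_on_compose2[OF assms(1)] continuous_intros)
       (use assms(2) in \<open>auto simp: norm_mult abs_le_iff\<close>)
  then have "((\<lambda>r::real. g (of_real r * z)) \<longlongrightarrow> g (of_real 1 * z)) (at 1 within {-1..1})"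
    unfolding continuous_on_def by (drule_tac x = 1 in bspec) auto
  then show ?thesis by (simp add: at_within_Icc_at_left)
qed

lemma eventually_at_left_1_unit: "eventually (\<lambda>r::real. 0 < r \<and> r < 1) (at_left 1)"
  using eventually_at_left_real[of 0 1] by simp

lemma Re_gap_sqrt_divide_sphere:
  assumes "0 < \<phi>" "\<phi> < pi" "norm z = 1" "z \<noteq> -1"
  shows "Re (gap_sqrt \<phi> z / (1 + z)) \<ge> 0"
proof -
  have "((\<lambda>r. Re (gap_sqrt \<phi> (of_real r * z) / (1 + of_real r * z))) \<longlongrightarrow>
          Re (gap_sqrt \<phi> z / (1 + of_real 1 * z))) (at_left 1)"
    by (intro tendsto_intros tendsto_radial continuous_on_gap_sqrt assms)
       (use assms(4) in \<open>auto simp: add_eq_0_iff\<close>)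
  moreover have "eventually (\<lambda>r. Re (gap_sqrt \<phi> (of_real r * z) / (1 + of_real r * z)) \<ge> 0) (at_left 1)"
    using eventually_at_left_1_unit
  proof eventually_elim
    case (elim r)
    then show ?case using Re_gap_sqrt_divide_pos(2)[of \<phi> "of_real r * z"] assms
      by (simp add: norm_mult less_imp_le)
  qed
  ultimately show ?thesis by (auto intro: tendsto_lowerbound)
qed

text \<open>The exponential of the complex potential of the equilibrium measure of the arc \<open>|arg z| \<ge> \<phi>\<close>, whose capacity is \<open>cos (\<phi>/2)\<close>.\<close>

definition gap_fun :: "real \<Rightarrow> complex \<Rightarrow> complex" where
  "gap_fun \<phi> z = (1 + z + gap_sqrt \<phi> z) / 2"

text \<open>The other root of this quadratic is \<open>(1 + z - gap_sqrt \<phi> z) / 2\<close>. The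
  equation takes the place of the square root in the boundary values and in the derivative.\<close>

lemma gap_fun_quadratic:
  "(gap_fun \<phi> z)\<^sup>2 = (1 + z) * gap_fun \<phi> z - z * (of_real (cos (\<phi>/2)))\<^sup>2"
proof -
  define x :: complex where "x = (of_real (cos (\<phi>/2)))\<^sup>2"
  have "cos \<phi> = 2 * (cos (\<phi>/2))\<^sup>2 - 1" using cos_double_cos[of "\<phi>/2"] by simp
  then have c: "of_real (cos \<phi>) = 2 * x - 1" by (simp add: x_def)
  have "gap_sqrt \<phi> z * gap_sqrt \<phi> z = 1 - 2 * (2 * x - 1) * z + z\<^sup>2"
    using gap_sqrt_power2[of \<phi> z] c by (simp add: power2_eq_square)
  then have "(1 + z + gap_sqrt \<phi> z)\<^sup>2 = 2 * (1 + z) * (1 + z + gap_sqrt \<phi> z) - 4 * (z * x)"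
    by (simp add: power2_eq_square algebra_simps)
  then show ?thesis unfolding gap_fun_def x_def[symmetric]
    by (simp add: power_divide)
qed

lemma gap_fun_nonzero:
  assumes "0 < \<phi>" "\<phi> < pi" shows "gap_fun \<phi> z \<noteq> 0"
proof
  assume 0: "gap_fun \<phi> z = 0"
  have "cos (\<phi>/2) > 0" using assms by (intro cos_gt_zero_pi) auto
  then have "z = 0" using gap_fun_quadratic[of \<phi> z] 0 by auto
  then show False using 0 by (simp add: gap_fun_def)
qed

text \<open>With \<open>v = cis (t/2)\<close> and \<open>X = cos (t/2)\<close> one has
  \<open>gap_fun \<phi> (v\<^sup>2) = v (X + y)\<close> where
  \<open>y\<^sup>2 = X\<^sup>2 - c\<^sup>2\<close>. On the arc \<open>y\<close> is imaginary and the
  modulus is the capacity; in the gap \<open>y\<close> is real and, by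
  \<open>Re_gap_sqrt_divide_sphere\<close>, of the same sign as \<open>X\<close>, so that absolute
  values add.\<close>

lemma norm_gap_fun_sphere:
  fixes t :: real
  assumes "0 < \<phi>" "\<phi> < pi"
  defines "c \<equiv> cos (\<phi>/2)" and "x \<equiv> \<bar>cos (t/2)\<bar>"
  shows "norm (gap_fun \<phi> (cis t)) = (if x \<le> c then c else x + sqrt (x\<^sup>2 - c\<^sup>2))"
proof -
  define v where "v = cis (t/2)"
  define X where "X = cos (t/2)"
  have x: "x = \<bar>X\<bar>" by (simp add: x_def X_def)
  have c: "c > 0" unfolding c_def using assms by (intro cos_gt_zero_pi) auto
  have v: "norm v = 1" "v \<noteq> 0" "cis t = v\<^sup>2" by (auto simp: v_def power2_eq_square cis_mult)
  have vX: "1 + v\<^sup>2 = 2 * v * of_real X"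
  proof -
    have "2 * of_real X = v + cis (- (t/2))" by (simp add: complex_eq_iff v_def X_def)
    then have "2 * v * of_real X = v * v + v * cis (-(t/2))" by (simp add: algebra_simps)
    then show ?thesis by (simp add: v_def cis_mult power2_eq_square)
  qed
  define y where "y = gap_sqrt \<phi> (cis t) / (2 * v)"
  have sy: "gap_sqrt \<phi> (cis t) = 2 * v * y" using v by (simp add: y_def)
  have Ey: "gap_fun \<phi> (cis t) = v * (of_real X + y)"
    unfolding gap_fun_def sy using v vX by (simp add: algebra_simps)
  have "(v * (of_real X + y))\<^sup>2 = 2 * v * of_real X * (v * (of_real X + y)) - v\<^sup>2 * of_real (c\<^sup>2)"
    using gap_fun_quadratic[of \<phi> "cis t"] unfolding Ey unfolding v(3) vX by (simp add: c_def)
  then have "v\<^sup>2 * (y\<^sup>2) = v\<^sup>2 * of_real (X\<^sup>2 - c\<^sup>2)"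
    by (simp add: algebra_simps power2_eq_square)
  then have y2: "y\<^sup>2 = of_real (X\<^sup>2 - c\<^sup>2)" using v(2) by simp
  show ?thesis
  proof (cases "x \<le> c")
    case True
    then have le: "X\<^sup>2 \<le> c\<^sup>2" using c x by (simp add: abs_le_square_iff[symmetric])
    have "Im (y\<^sup>2) = 0" "Re (y\<^sup>2) \<le> 0" using y2 le by auto
    then have "Re y = 0 \<or> Im y = 0" "(Re y)\<^sup>2 \<le> (Im y)\<^sup>2" by (auto simp: power2_eq_square)
    then have "Re y = 0" by auto
    moreover have "(Im y)\<^sup>2 = c\<^sup>2 - X\<^sup>2"
      using arg_cong[OF y2, of Re] \<open>Re y = 0\<close> by (simp add: power2_eq_square)
    ultimately have "norm (of_real X + y) = c" using c by (simp add: cmod_def)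
    then show ?thesis unfolding Ey norm_mult v(1) using True by simp
  next
    case False
    then have "\<not> X\<^sup>2 \<le> c\<^sup>2" using c x by (simp add: abs_le_square_iff[symmetric])
    then have gt: "X\<^sup>2 > c\<^sup>2" by simp
    have X0: "X \<noteq> 0" using False c x by auto
    have ne: "cis t \<noteq> -1" using vX v X0 by (auto simp: add_eq_0_iff)
    have "gap_sqrt \<phi> (cis t) / (1 + cis t) = y / of_real X"
      unfolding y_def unfolding v(3) vX using v(2) X0 by simp
    then have "Re (y / of_real X) \<ge> 0"
      using Re_gap_sqrt_divide_sphere[OF assms(1,2) _ ne] by simp
    then have sgn: "Re y / X \<ge> 0" by simp
    have "Im (y\<^sup>2) = 0" "Re (y\<^sup>2) > 0" using y2 gt by auto
    then have "Im y = 0" by (auto simp: power2_eq_square)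
    then have "(Re y)\<^sup>2 = X\<^sup>2 - c\<^sup>2" using arg_cong[OF y2, of Re] by (simp add: power2_eq_square)
    then have "\<bar>Re y\<bar> = sqrt (X\<^sup>2 - c\<^sup>2)" by (metis real_sqrt_abs)
    moreover have "norm (of_real X + y) = \<bar>X + Re y\<bar>" using \<open>Im y = 0\<close> by (simp add: cmod_def)
    moreover have "\<bar>X + Re y\<bar> = \<bar>X\<bar> + \<bar>Re y\<bar>" using sgn X0 by (auto simp: zero_le_divide_iff)
    ultimately show ?thesis unfolding Ey norm_mult v(1) using False x by simp
  qed
qed

text \<open>For \<open>u >= 0\<close> the derivative of \<open>ln (cosh u)\<close> is
  \<open>tanh u\<close>, which is at most \<open>u\<close>. This yields
  \<open>c cosh u <= cos (pi l / 2)\<close> for the constant \<open>c\<close> of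
  \<open>one_gap_certificate\<close>.\<close>

lemma cosh_le_exp_half_square: "cosh (u::real) \<le> exp (u\<^sup>2 / 2)"
proof -
  have *: "0 \<le> exp (u\<^sup>2/2) - cosh u" if "u \<ge> 0" for u :: real
  proof -
    have s: "sinh x \<le> x * cosh x" if "x \<ge> 0" for x :: real
    proof -
      have "0 * cosh 0 - sinh 0 \<le> x * cosh x - sinh x"
        by (rule DERIV_nonneg_imp_nondecreasing[OF that, of "\<lambda>x. x * cosh x - sinh x"])
           (auto intro!: exI derivative_eq_intros mult_nonneg_nonneg)
      then show ?thesis by simp
    qed
    have "ln (cosh 0) - 0\<^sup>2/2 \<ge> ln (cosh u) - u\<^sup>2/2"
    proof (rule DERIV_nonpos_imp_nonincreasing[OF that, of "\<lambda>x. ln (cosh x) - x\<^sup>2/2"])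
      fix x :: real assume "0 \<le> x"
      then show "\<exists>y. ((\<lambda>x. ln (cosh x) - x\<^sup>2/2) has_real_derivative y) (at x) \<and> y \<le> 0"
        using s[of x] by (intro exI[of _ "sinh x / cosh x - x"]) (auto intro!: derivative_eq_intros simp: field_simps)
    qed
    then have "ln (cosh u) \<le> u\<^sup>2/2" by simp
    then have "exp (ln (cosh u)) \<le> exp (u\<^sup>2/2)" by (simp only: exp_le_cancel_iff)
    then show ?thesis by simp
  qed
  show ?thesis using *[of "\<bar>u\<bar>"] by (cases "u \<ge> 0") auto
qed

text \<open>\<open>F\<close> is the logarithm of \<open>gap_fun\<close> for the arc of capacity
  \<open>c\<close>. Its real part tends to at least \<open>ln c\<close> on the whole circle, and to
  at least \<open>u + ln c\<close> where \<open>|cos (t/2)| >= c cosh u\<close>, because there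
  \<open>x + sqrt (x\<^sup>2 - c\<^sup>2) >= c exp u\<close>. The value of \<open>c\<close> ensures
  this for \<open>|t| <= pi l\<close>.\<close>

lemma one_gap_certificate:
  assumes l: "0 \<le> l" "l < 1" and u: "0 < u"
  defines "c \<equiv> cos (pi * l / 2) * exp (- (u\<^sup>2) / 2)"
  obtains F where "F holomorphic_on ball 0 1" "F 0 = 0"
    "\<And>z. z \<in> ball 0 1 \<Longrightarrow> Re (z * deriv F z) \<le> 1/2"
    "\<And>t e. \<bar>t\<bar> \<le> pi * l \<Longrightarrow> e > 0 \<Longrightarrow> eventually (\<lambda>r. Re (F (of_real r * cis t)) \<ge> u + ln c - e) (at_left 1)"
    "\<And>t e. e > 0 \<Longrightarrow> eventually (\<lambda>r. Re (F (of_real r * cis t)) \<ge> ln c - e) (at_left 1)"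
proof -
  have k0: "cos (pi * l / 2) > 0" using l by (intro cos_gt_zero_pi) (auto simp: less_divide_eq_1 intro: order_less_le_trans[of _ 0])
  have c0: "0 < c" using k0 by (simp add: c_def)
  have "c \<le> exp (- (u\<^sup>2) / 2)" unfolding c_def using cos_le_one[of "pi * l / 2"] by simp
  also have "\<dots> < 1" using u by simp
  finally have c1: "c < 1" .
  define \<phi> where "\<phi> = 2 * arccos c"
  have "arccos c > 0" using arccos_less_mono[of 1 c] c0 c1 by simp
  moreover have "arccos c < pi/2" using arccos_less_mono[of c 0] c0 c1 by simp
  ultimately have \<phi>: "0 < \<phi>" "\<phi> < pi" by (auto simp: \<phi>_def)
  have c: "cos (\<phi>/2) = c" using c0 c1 by (simp add: \<phi>_def)
  let ?E = "gap_fun \<phi>"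
  have E0: "?E 0 = 1" by (simp add: gap_fun_def)
  have contE: "continuous_on (cball 0 1) ?E"
    unfolding gap_fun_def by (intro continuous_intros continuous_on_gap_sqrt) auto
  have holE: "?E holomorphic_on ball 0 1"
    unfolding gap_fun_def by (intro holomorphic_intros holomorphic_on_gap_sqrt) auto
  have nzE: "?E z \<noteq> 0" for z using gap_fun_nonzero \<phi> by blast
  obtain g where g: "g holomorphic_on ball 0 1" "\<And>z. z \<in> ball 0 1 \<Longrightarrow> exp (g z) = ?E z"
    using holomorphic_logarithm_exists[of "ball 0 1" ?E 0] holE nzE by auto
  define F where "F z = g z - g 0" for z
  have F0: "F 0 = 0" by (simp add: F_def)
  have holF: "F holomorphic_on ball 0 1" unfolding F_def by (intro holomorphic_intros g)
  have expF: "exp (F z) = ?E z" if "z \<in> ball 0 1" for z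
    using g(2)[OF that] g(2)[of 0] E0 by (simp add: F_def exp_diff)
  have ReF: "Re (F z) = ln (norm (?E z))" if "z \<in> ball 0 1" for z
    using expF[OF that, symmetric] by simp
  have pos: "Re (z * deriv F z) \<le> 1/2" if z: "z \<in> ball 0 1" for z
  proof -
    let ?s = "gap_sqrt \<phi> z"
    have dF: "(F has_field_derivative deriv F z) (at z)" using holF z by (simp add: holomorphic_derivI)
    have "((\<lambda>z. exp (F z)) has_field_derivative ?E z * deriv F z) (at z)"
      using expF[OF z] by (auto intro!: derivative_eq_intros dF)
    then have dE: "(?E has_field_derivative ?E z * deriv F z) (at z)"
      by (rule has_field_derivative_transform_within_open[where S = "ball 0 1"]) (use z expF in auto)
    \<comment> \<open>Implicit differentiation of \<open>gap_fun_quadratic\<close> leads to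
      \<open>1 - 2 z F' = (1 - z) / gap_sqrt \<phi> z\<close>, whose real part is positive by
      \<open>Re_gap_sqrt_divide_pos\<close>.\<close>
    have "((\<lambda>z. (?E z)\<^sup>2) has_field_derivative 2 * ?E z * (?E z * deriv F z)) (at z)"
      by (auto intro!: derivative_eq_intros dE)
    moreover have "((\<lambda>z. (1 + z) * ?E z - z * (of_real c)\<^sup>2) has_field_derivative
        ?E z + (1 + z) * (?E z * deriv F z) - (of_real c)\<^sup>2) (at z)"
      by (auto intro!: derivative_eq_intros dE)
    moreover have "(\<lambda>z. (?E z)\<^sup>2) = (\<lambda>z. (1 + z) * ?E z - z * (of_real c)\<^sup>2)"
      using gap_fun_quadratic[of \<phi>] by (auto simp: c)
    ultimately have e1: "2 * ?E z * (?E z * deriv F z) = ?E z + (1 + z) * (?E z * deriv F z) - (of_real c)\<^sup>2"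
      by (metis DERIV_unique)
    have e2: "(?E z)\<^sup>2 = (1 + z) * ?E z - z * (of_real c)\<^sup>2" using gap_fun_quadratic[of \<phi> z] by (simp add: c)
    have s: "?s = 2 * ?E z - 1 - z" by (simp add: gap_fun_def field_simps)
    have "?E z * (?s * (z * deriv F z)) = ?E z * (?E z - 1)"
      using e1 e2 s by algebra
    then have "?s * (z * deriv F z) = ?E z - 1" using nzE by simp
    then have "?s * (1 - 2 * (z * deriv F z)) = 1 - z" using s by algebra
    moreover have "?s \<noteq> 0" using gap_sqrt_nonzero z by simp
    ultimately have "1 - 2 * (z * deriv F z) = inverse (?s / (1 - z))" by (simp add: field_simps)
    moreover have "Re (inverse (?s / (1 - z))) \<ge> 0"
      using Re_gap_sqrt_divide_pos(1)[OF \<phi>, of z] z by (simp add: Re_inverse less_imp_le del: inverse_divide)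
    ultimately have "Re (1 - 2 * (z * deriv F z)) \<ge> 0" by simp
    then show ?thesis by simp
  qed
  have ev: "eventually (\<lambda>r. Re (F (of_real r * cis t)) \<ge> b - e) (at_left 1)"
    if b: "b \<le> ln (norm (?E (cis t)))" and e: "e > 0" for t b e
  proof -
    have "((\<lambda>r. ln (norm (?E (of_real r * cis t)))) \<longlongrightarrow> ln (norm (?E (cis t)))) (at_left 1)"
      by (intro tendsto_intros tendsto_radial contE) (use nzE in auto)
    then have "eventually (\<lambda>r. ln (norm (?E (of_real r * cis t))) > b - e) (at_left 1)"
      using b e by (intro order_tendstoD) auto
    then show ?thesis using eventually_at_left_1_unit
    proof eventually_elim
      case (elim r)
      then show ?case by (subst ReF) (auto simp: norm_mult)
    qed
  qed
  have lower: "ln c \<le> ln (norm (?E (cis t)))" for t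
  proof -
    have "c \<le> x + sqrt (x\<^sup>2 - c\<^sup>2)" if "\<not> x \<le> c" for x
    proof -
      have "c\<^sup>2 \<le> x\<^sup>2" using that c0 by (intro power_mono) auto
      then show ?thesis using that by (intro add_increasing2) auto
    qed
    then have "c \<le> norm (?E (cis t))"
      unfolding norm_gap_fun_sphere[OF \<phi>] c if_distrib[of "(\<le>) c"]
      by (auto simp only: order_refl split: if_splits)
    then show ?thesis using c0 nzE[of "cis t"] by (subst ln_le_cancel_iff) auto
  qed
  have upper: "u + ln c \<le> ln (norm (?E (cis t)))" if t: "\<bar>t\<bar> \<le> pi * l" for t
  proof -
    define x where "x = \<bar>cos (t/2)\<bar>"
    have "cos (pi * l / 2) \<le> cos \<bar>t/2\<bar>"
      using t l by (subst cos_mono_le_eq) (auto simp: mult_left_le intro: order_trans[OF t])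
    then have "cos (pi * l / 2) \<le> cos (t/2)" by (simp only: cos_abs_real)
    then have x: "x \<ge> cos (pi * l / 2)" by (simp add: x_def)
    have "c * cosh u \<le> c * exp (u\<^sup>2/2)" using cosh_le_exp_half_square c0 by simp
    also have "\<dots> = cos (pi * l / 2)" by (simp add: c_def flip: exp_add)
    finally have xc: "x \<ge> c * cosh u" using x by linarith
    have ch: "cosh u > 1" using u cosh_real_ge_1[of u] cosh_real_one_iff[of u] by (simp add: order_less_le)
    then have "c < c * cosh u" using c0 by simp
    then have "x > c" using xc by linarith
    have "(c * sinh u)\<^sup>2 = (c * cosh u)\<^sup>2 - c\<^sup>2" by (simp add: power_mult_distrib cosh_square_eq algebra_simps)
    also have "\<dots> \<le> x\<^sup>2 - c\<^sup>2" using xc c0 ch by (simp add: power_mono)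
    finally have "c * sinh u \<le> sqrt (x\<^sup>2 - c\<^sup>2)" by (rule real_le_rsqrt)
    then have "c * exp u \<le> x + sqrt (x\<^sup>2 - c\<^sup>2)" using xc
      by (simp add: cosh_plus_sinh[symmetric] distrib_left)
    also have "\<dots> = norm (?E (cis t))" 
      unfolding norm_gap_fun_sphere[OF \<phi>] c using \<open>x > c\<close> by (simp add: x_def)
    finally have "ln (c * exp u) \<le> ln (norm (?E (cis t)))"
      using c0 nzE by (subst ln_le_cancel_iff) auto
    then show ?thesis using c0 by (simp add: ln_mult)
  qed
  show thesis
    by (rule that[OF holF F0 pos]) (use ev lower upper in auto)
qed

section \<open>A conformal map onto a half disc\<close>

lemma Re_gap_sqrt_divide_sphere':
  assumes "0 < \<phi>" "\<phi> < pi" "norm z = 1" "z \<noteq> 1"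
  shows "Re (gap_sqrt \<phi> z / (1 - z)) \<ge> 0"
proof -
  have "((\<lambda>r. Re (gap_sqrt \<phi> (of_real r * z) / (1 - of_real r * z))) \<longlongrightarrow>
          Re (gap_sqrt \<phi> z / (1 - of_real 1 * z))) (at_left 1)"
    by (intro tendsto_intros tendsto_radial continuous_on_gap_sqrt assms)
       (use assms(4) in auto)
  moreover have "eventually (\<lambda>r. Re (gap_sqrt \<phi> (of_real r * z) / (1 - of_real r * z)) \<ge> 0) (at_left 1)"
    using eventually_at_left_1_unit
  proof eventually_elim
    case (elim r)
    then show ?case using Re_gap_sqrt_divide_pos(1)[of \<phi> "of_real r * z"] assms
      by (simp add: norm_mult less_imp_le)
  qed
  ultimately show ?thesis by (auto intro: tendsto_lowerbound)
qed

text \<open>The difference \<open>5/2 tan x - tan (5/2 x)\<close> vanishes at 0 and has nonpositive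
  derivative. The lemma serves to make \<open>half_disc_map\<close> small at angles of at least
  \<open>5/2 \<phi>\<close>.\<close>

lemma tan_five_halves:
  assumes "0 < x" "5/2 * x \<le> y" "y < pi/2"
  shows "5/2 * tan x \<le> tan y"
proof -
  have "5/2 * tan 0 - tan (5/2 * 0) \<ge> 5/2 * tan x - tan (5/2 * x)"
  proof (rule DERIV_nonpos_imp_nonincreasing[of 0 x "\<lambda>x. 5/2 * tan x - tan (5/2 * x)"])
    fix z assume z: "0 \<le> z" "z \<le> x"
    have c: "cos (5/2 * z) > 0" "cos z > 0" using z assms by (auto intro!: cos_gt_zero_pi)
    have "cos (5/2 * z) \<le> cos z" using z assms by (intro cos_monotone_0_pi_le) auto
    then have "inverse ((cos z)\<^sup>2) \<le> inverse ((cos (5/2 * z))\<^sup>2)"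
      using c by (intro le_imp_inverse_le power_mono) auto
    then show "\<exists>y. ((\<lambda>x. 5/2 * tan x - tan (5/2 * x)) has_real_derivative y) (at z) \<and> y \<le> 0"
      using c by (intro exI[of _ "5/2 * inverse ((cos z)\<^sup>2) - 5/2 * inverse ((cos (5/2 * z))\<^sup>2)"])
         (auto intro!: derivative_eq_intros)
  qed (use assms in auto)
  moreover have "tan (5/2 * x) \<le> tan y" using assms by (subst tan_mono_le_eq) auto
  ultimately show ?thesis by simp
qed

text \<open>The conformal map \<open>u\<close> of the disc onto \<open>{|u| < 1, Re u > 0}\<close> with \<open>1/u - u = 2 cot (\<phi>/2) (1 - z)/(1 + z)\<close>; it sends the arc
  \<open>|arg z| \<ge> \<phi>\<close> to the imaginary axis.\<close>

definition half_disc_map :: "real \<Rightarrow> complex \<Rightarrow> complex" where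
  "half_disc_map \<phi> z =
     of_real (sin (\<phi>/2)) * (1 + z) / (of_real (cos (\<phi>/2)) * (1 - z) + gap_sqrt \<phi> z)"

context
  fixes \<phi> :: real
  assumes \<phi>: "0 < \<phi>" "\<phi> < pi"
begin

private lemma cs_pos: "cos (\<phi>/2) > 0" "sin (\<phi>/2) > 0"
  using \<phi> by (auto intro!: cos_gt_zero_pi sin_gt_zero)

lemma half_disc_map_denom_nonzero:
  assumes "norm z \<le> 1"
  shows "of_real (cos (\<phi>/2)) * (1 - z) + gap_sqrt \<phi> z \<noteq> 0" (is "?D \<noteq> 0")
proof (cases "z = 1")
  case True
  then have "(gap_sqrt \<phi> z)\<^sup>2 = of_real ((2 * sin (\<phi>/2))\<^sup>2)"
    using gap_sqrt_power2'[of \<phi> z] by (simp add: power_mult_distrib)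
  then show ?thesis using True cs_pos by auto
next
  case False
  have "Re (gap_sqrt \<phi> z / (1 - z)) \<ge> 0"
    using Re_gap_sqrt_divide_sphere'[OF \<phi> _ False] Re_gap_sqrt_divide_pos(1)[OF \<phi>, of z] assms
    by (cases "norm z = 1") auto
  moreover have "?D / (1 - z) = of_real (cos (\<phi>/2)) + gap_sqrt \<phi> z / (1 - z)"
    using False by (simp add: field_simps)
  ultimately have "Re (?D / (1 - z)) > 0" using cs_pos by simp
  then show ?thesis by force
qed

text \<open>This is the defining equation of the map with denominators cleared, so that it also
  covers \<open>z = -1\<close> and zeros of the map.\<close>

lemma half_disc_map_eq:
  assumes "norm z \<le> 1"
  shows "of_real (sin (\<phi>/2)) * (1 + z) * (1 - (half_disc_map \<phi> z)\<^sup>2) =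
         2 * of_real (cos (\<phi>/2)) * (1 - z) * half_disc_map \<phi> z"
proof -
  define D where "D = of_real (cos (\<phi>/2)) * (1 - z) + gap_sqrt \<phi> z"
  define \<sigma> c :: complex where "\<sigma> = of_real (sin (\<phi>/2))" and "c = of_real (cos (\<phi>/2))"
  define u where "u = half_disc_map \<phi> z"
  have D: "D \<noteq> 0" using half_disc_map_denom_nonzero[OF assms] by (simp add: D_def)
  have s: "gap_sqrt \<phi> z = D - c * (1 - z)" by (simp add: D_def c_def)
  have uD: "u * D = \<sigma> * (1 + z)" using D by (simp add: u_def half_disc_map_def D_def \<sigma>_def)
  have "(D - c * (1 - z))\<^sup>2 = c\<^sup>2 * (1 - z)\<^sup>2 + \<sigma>\<^sup>2 * (1 + z)\<^sup>2"
    using gap_sqrt_power2'[of \<phi> z] unfolding s by (simp add: \<sigma>_def c_def)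
  then have "(D * D) * (\<sigma> * (1 + z) * (1 - u\<^sup>2)) = (D * D) * (2 * c * (1 - z) * u)"
    using uD by algebra
  then show ?thesis using D by (simp add: u_def \<sigma>_def c_def)
qed

lemma half_disc_map_0: "half_disc_map \<phi> 0 = of_real (sin (\<phi>/2) / (1 + cos (\<phi>/2)))"
  by (simp add: half_disc_map_def add.commute)

lemma continuous_on_half_disc_map: "continuous_on (cball 0 1) (half_disc_map \<phi>)"
  unfolding half_disc_map_def
  by (intro continuous_intros continuous_on_gap_sqrt) (use half_disc_map_denom_nonzero in auto)

lemma holomorphic_on_half_disc_map: "half_disc_map \<phi> holomorphic_on ball 0 1"
  unfolding half_disc_map_def
  by (intro holomorphic_intros holomorphic_on_gap_sqrt) (use half_disc_map_denom_nonzero in auto)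

text \<open>\<open>1/u\<close> is a positive combination of \<open>(1 - z) / (1 + z)\<close> and
  \<open>gap_sqrt \<phi> z / (1 + z)\<close>, both in the right half plane, hence
  \<open>Re u > 0\<close>. Moreover \<open>Re (1/u - u) = Re u (1/|u|\<^sup>2 - 1)\<close> is a
  positive multiple of the real part of \<open>(1 - z) / (1 + z)\<close>, hence
  \<open>|u| < 1\<close>.\<close>

lemma half_disc_map_ball:
  assumes "norm z < 1"
  shows "Re (half_disc_map \<phi> z) > 0" "norm (half_disc_map \<phi> z) < 1"
proof -
  define u where "u = half_disc_map \<phi> z"
  have z: "1 + z \<noteq> 0" "1 - z \<noteq> 0" using assms by (auto simp: add_eq_0_iff)
  have s0: "complex_of_real (sin (\<phi>/2)) \<noteq> 0" using cs_pos by simp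
  define X Y where "X = (1 - z) / (1 + z)" and "Y = gap_sqrt \<phi> z / (1 + z)"
  have XY: "Re X > 0" "Re Y > 0"
    using Re_gap_sqrt_divide_pos(2)[OF \<phi> assms] Re_moebius_pos(2)[OF assms] by (auto simp: X_def Y_def)
  have "inverse u = of_real (cos (\<phi>/2) / sin (\<phi>/2)) * X + of_real (1 / sin (\<phi>/2)) * Y"
    using z s0 by (simp add: u_def half_disc_map_def X_def Y_def divide_simps)
  then have "Re (inverse u) = cos (\<phi>/2) / sin (\<phi>/2) * Re X + 1 / sin (\<phi>/2) * Re Y"
    by simp
  then have "Re (inverse u) > 0"
    using XY cs_pos by (simp add: add_pos_pos)
  then have u0: "u \<noteq> 0" and "Re u / (norm u)\<^sup>2 > 0" by (auto simp: Re_inverse cmod_power2)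
  then have Re: "Re u > 0" by (simp add: zero_less_divide_iff)
  then show "Re (half_disc_map \<phi> z) > 0" by (simp add: u_def)
  define \<sigma> c :: complex where "\<sigma> = of_real (sin (\<phi>/2))" and "c = of_real (cos (\<phi>/2))"
  have \<sigma>: "\<sigma> * (1 + z) * u \<noteq> 0" using s0 z u0 by (simp add: \<sigma>_def)
  have "inverse u - u = (\<sigma> * (1 + z) * (1 - u\<^sup>2)) / (\<sigma> * (1 + z) * u)"
    using \<sigma> by (simp add: diff_divide_distrib power2_eq_square inverse_eq_divide)
  also have "\<sigma> * (1 + z) * (1 - u\<^sup>2) = 2 * c * (1 - z) * u"
    using half_disc_map_eq[of z] assms by (simp add: u_def \<sigma>_def c_def)
  also have "2 * c * (1 - z) * u / (\<sigma> * (1 + z) * u) = of_real (2 * cos (\<phi>/2) / sin (\<phi>/2)) * X"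
    using \<sigma> by (simp add: X_def \<sigma>_def c_def)
  finally have "inverse u - u = of_real (2 * cos (\<phi>/2) / sin (\<phi>/2)) * X" .
  then have "Re (inverse u - u) = 2 * cos (\<phi>/2) / sin (\<phi>/2) * Re X"
    by simp
  then have "Re (inverse u - u) > 0" using XY cs_pos by simp
  then have "Re u < Re u / (norm u)\<^sup>2" by (simp add: Re_inverse cmod_power2)
  then have "(norm u)\<^sup>2 < 1" using Re u0 by (simp add: field_simps)
  then show "norm (half_disc_map \<phi> z) < 1" by (simp add: u_def power_less_one_iff abs_square_less_1)
qed

lemma half_disc_map_sphere:
  assumes "norm z = 1"
  shows "Re (half_disc_map \<phi> z) \<ge> 0" "norm (half_disc_map \<phi> z) \<le> 1"
proof -
  have lim: "((\<lambda>r. half_disc_map \<phi> (of_real r * z)) \<longlongrightarrow> half_disc_map \<phi> z) (at_left 1)"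
    by (intro tendsto_radial continuous_on_half_disc_map assms)
  have "eventually (\<lambda>r. Re (half_disc_map \<phi> (of_real r * z)) \<ge> 0 \<and> norm (half_disc_map \<phi> (of_real r * z)) \<le> 1) (at_left 1)"
    using eventually_at_left_1_unit
  proof eventually_elim
    case (elim r)
    then show ?case using half_disc_map_ball[of "of_real r * z"] assms by (simp add: norm_mult less_imp_le)
  qed
  then have "eventually (\<lambda>r. Re (half_disc_map \<phi> (of_real r * z)) \<ge> 0) (at_left 1)"
    "eventually (\<lambda>r. norm (half_disc_map \<phi> (of_real r * z)) \<le> 1) (at_left 1)"
    by (auto elim: eventually_mono)
  then show "Re (half_disc_map \<phi> z) \<ge> 0" "norm (half_disc_map \<phi> z) \<le> 1"
    using tendsto_lowerbound[OF tendsto_Re[OF lim]] tendsto_upperbound[OF tendsto_norm[OF lim]] by auto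
qed

section \<open>Boundary values of the half disc map\<close>

lemma half_disc_map_cis_eq:
  fixes t :: real
  defines "u \<equiv> half_disc_map \<phi> (cis t)"
  shows "of_real (sin (\<phi>/2) * cos (t/2)) * (1 - u\<^sup>2) = - 2 * \<i> * of_real (cos (\<phi>/2) * sin (t/2)) * u"
proof -
  define v where "v = cis (t/2)"
  have v: "cis t = v * v" "v \<noteq> 0" by (auto simp: v_def cis_mult)
  have vv: "v * cis (- (t/2)) = 1" by (simp add: v_def cis_mult)
  have "2 * of_real (cos (t/2)) = v + cis (- (t/2))" by (simp add: complex_eq_iff v_def)
  then have p: "1 + cis t = 2 * v * of_real (cos (t/2))" using vv unfolding v(1) by algebra
  have "2 * \<i> * of_real (sin (t/2)) = v - cis (- (t/2))" by (simp add: complex_eq_iff v_def)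
  then have m: "1 - cis t = - 2 * \<i> * v * of_real (sin (t/2))" using vv unfolding v(1) by algebra
  \<comment> \<open>The common factor \<open>2 v\<close> of \<open>1 + z\<close> and
    \<open>1 - z\<close> at \<open>z = cis t\<close> cancels; in effect
    \<open>(1 - z) / (1 + z) = - i tan (t/2)\<close>.\<close>
  have "(2 * v) * (of_real (sin (\<phi>/2) * cos (t/2)) * (1 - u\<^sup>2)) =
        (2 * v) * (- 2 * \<i> * of_real (cos (\<phi>/2) * sin (t/2)) * u)"
    using half_disc_map_eq[of "cis t"] unfolding u_def[symmetric] p m by (simp add: algebra_simps)
  then show ?thesis by (rule mult_left_cancel[THEN iffD1, rotated]) (use v in auto)
qed

text \<open>The two parts of the complex equation. The second one factors: a boundary value is
  imaginary or has its imaginary part prescribed by \<open>t\<close>.\<close>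

lemma half_disc_map_cis_coords:
  fixes t :: real
  defines "u \<equiv> half_disc_map \<phi> (cis t)"
  shows "sin (\<phi>/2) * cos (t/2) * (1 - (Re u)\<^sup>2 + (Im u)\<^sup>2) = 2 * (cos (\<phi>/2) * sin (t/2)) * Im u"
    and "Re u * (Im u * (sin (\<phi>/2) * cos (t/2)) - cos (\<phi>/2) * sin (t/2)) = 0"
proof -
  note eq = half_disc_map_cis_eq[of t, folded u_def]
  show "sin (\<phi>/2) * cos (t/2) * (1 - (Re u)\<^sup>2 + (Im u)\<^sup>2) = 2 * (cos (\<phi>/2) * sin (t/2)) * Im u"
    using arg_cong[OF eq, of Re] by (simp add: power2_eq_square algebra_simps)
  have "sin (\<phi>/2) * cos (t/2) * (2 * (Re u * Im u)) = 2 * (cos (\<phi>/2) * sin (t/2)) * Re u"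
    using arg_cong[OF eq, of Im] by (simp add: power2_eq_square algebra_simps)
  then show "Re u * (Im u * (sin (\<phi>/2) * cos (t/2)) - cos (\<phi>/2) * sin (t/2)) = 0"
    by (simp add: algebra_simps)
qed

lemma half_disc_map_cos_0:
  assumes "cos (t/2) = 0" shows "half_disc_map \<phi> (cis t) = 0"
proof -
  have "sin (t/2) \<noteq> 0" using sin_cos_squared_add[of "t/2"] assms by auto
  then show ?thesis using half_disc_map_cis_eq[of t] assms cs_pos by simp
qed

text \<open>Taking norms in \<open>half_disc_map_cis_eq\<close> gives
  \<open>5 |u| <= 1 + |u|\<^sup>2\<close>. As \<open>|u| <= 1\<close>, this forces
  \<open>|u| <= (5 - sqrt 21) / 2\<close>, which is below 11/50.\<close>

lemma half_disc_map_small: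
  assumes "5/2 * (sin (\<phi>/2) * \<bar>cos (t/2)\<bar>) \<le> cos (\<phi>/2) * \<bar>sin (t/2)\<bar>"
  shows "norm (half_disc_map \<phi> (cis t)) \<le> 11/50"
proof (cases "cos (t/2) = 0")
  case True
  then show ?thesis by (simp add: half_disc_map_cos_0)
next
  case False
  define u where "u = half_disc_map \<phi> (cis t)"
  define k where "k = sin (\<phi>/2) * \<bar>cos (t/2)\<bar>"
  have k: "k > 0" using False cs_pos by (simp add: k_def)
  have u1: "norm u \<le> 1" using half_disc_map_sphere(2)[of "cis t"] by (simp add: u_def)
  have "2 * (5/2 * k) * norm u \<le> 2 * (cos (\<phi>/2) * \<bar>sin (t/2)\<bar>) * norm u"
    using assms unfolding k_def by (intro mult_right_mono mult_left_mono) auto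
  also have "\<dots> = k * norm (1 - u\<^sup>2)"
    using arg_cong[OF half_disc_map_cis_eq[of t, folded u_def], of norm] cs_pos
    by (simp add: norm_mult k_def abs_mult)
  also have "norm (1 - u\<^sup>2) \<le> 1 + (norm u)\<^sup>2" using norm_triangle_ineq4[of 1 "u\<^sup>2"] by (simp add: norm_power)
  finally have "k * (5 * norm u) \<le> k * (1 + (norm u)\<^sup>2)" using k by simp
  then have q: "5 * norm u \<le> 1 + (norm u)\<^sup>2" using k by simp
  show ?thesis
  proof (rule ccontr)
    assume gt: "\<not> ?thesis"
    \<comment> \<open>Between 11/50 and 1 the square lies below its chord, which makes the quadratic
      inequality linear.\<close>
    then have "(norm u - 11/50) * (1 - norm u) \<ge> 0" using u1 by (simp add: u_def)
    moreover have "(norm u - 11/50) * (1 - norm u) = 61/50 * norm u - 11/50 - (norm u)\<^sup>2"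
      by (simp add: field_simps power2_eq_square)
    ultimately have "(norm u)\<^sup>2 \<le> 61/50 * norm u - 11/50" by linarith
    then show False using q gt by (simp add: u_def)
  qed
qed

text \<open>Multiplying the first identity of \<open>half_disc_map_cis_coords\<close> by
  \<open>cos (t/2)\<close> shows that \<open>Im u\<close> times \<open>sin t\<close> is positive
  unless \<open>Im u = 0\<close>.\<close>

lemma half_disc_map_sin_sign:
  "Im (half_disc_map \<phi> (cis t)) > 0 \<Longrightarrow> sin t > 0"
  "Im (half_disc_map \<phi> (cis t)) < 0 \<Longrightarrow> sin t < 0"
proof -
  define u where "u = half_disc_map \<phi> (cis t)"
  define C S where "C = cos (t/2)" and "S = sin (t/2)"
  have st: "sin t = 2 * (S * C)" using sin_double[of "t/2"] by (simp add: C_def S_def)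
  have "norm u \<le> 1" using half_disc_map_sphere(2)[of "cis t"] by (simp add: u_def)
  then have "(Re u)\<^sup>2 \<le> 1" using abs_Re_le_cmod[of u] by (simp add: abs_square_le_1)
  have *: "0 < S * C * Im u" if "Im u \<noteq> 0"
  proof -
    have "C \<noteq> 0" using half_disc_map_cos_0[of t] that by (auto simp: u_def C_def)
    moreover have "1 - (Re u)\<^sup>2 + (Im u)\<^sup>2 > 0" using \<open>(Re u)\<^sup>2 \<le> 1\<close> that by (simp add: add_nonneg_pos)
    ultimately have "0 < sin (\<phi>/2) * C\<^sup>2 * (1 - (Re u)\<^sup>2 + (Im u)\<^sup>2)" using cs_pos by simp
    also have "\<dots> = 2 * cos (\<phi>/2) * (S * C * Im u)"
      using half_disc_map_cis_coords(1)[of t, folded u_def] unfolding C_def S_def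
      by (simp add: power2_eq_square mult_ac)
    finally show ?thesis using cs_pos by (simp add: zero_less_mult_iff)
  qed
  show "Im (half_disc_map \<phi> (cis t)) > 0 \<Longrightarrow> sin t > 0"
    using * unfolding st u_def[symmetric] by (simp add: zero_less_mult_iff)
  show "Im (half_disc_map \<phi> (cis t)) < 0 \<Longrightarrow> sin t < 0"
    using * unfolding st u_def[symmetric] by (auto simp: zero_less_mult_iff mult_less_0_iff)
qed

text \<open>If \<open>Re u\<close> were nonzero, the coordinate identities would give
  \<open>Im u * C = S\<close> and \<open>|u| = 1\<close>. For these \<open>t\<close> one has
  \<open>|C| <= S\<close>, hence \<open>|Im u| >= 1\<close>, which leaves no room for
  \<open>Re u\<close>.\<close>

lemma half_disc_map_Re_0:
  assumes "\<phi> \<le> t" "t \<le> 2 * pi - \<phi>"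
  shows "Re (half_disc_map \<phi> (cis t)) = 0"
proof (rule ccontr)
  define u where "u = half_disc_map \<phi> (cis t)"
  define C S where "C = sin (\<phi>/2) * cos (t/2)" and "S = cos (\<phi>/2) * sin (t/2)"
  assume "Re (half_disc_map \<phi> (cis t)) \<noteq> 0"
  then have a: "Re u \<noteq> 0" by (simp add: u_def)
  then have "cos (t/2) \<noteq> 0" using half_disc_map_cos_0[of t] by (auto simp: u_def)
  then have C: "C \<noteq> 0" using cs_pos by (simp add: C_def)
  have b: "Im u * C = S"
    using half_disc_map_cis_coords(2)[of t, folded u_def] a by (simp add: C_def S_def)
  then have "C * (1 - (Re u)\<^sup>2 + (Im u)\<^sup>2) = C * (2 * (Im u)\<^sup>2)"
    using half_disc_map_cis_coords(1)[of t, folded u_def C_def S_def] by (simp add: power2_eq_square algebra_simps)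
  then have n: "(Re u)\<^sup>2 + (Im u)\<^sup>2 = 1" using C by simp
  have "sin (t/2 - \<phi>/2) \<ge> 0" "sin (t/2 + \<phi>/2) \<ge> 0" using assms \<phi> by (auto intro!: sin_ge_zero)
  then have "\<bar>C\<bar> \<le> S" by (simp add: sin_diff sin_add C_def S_def mult.commute abs_le_iff)
  then have "\<bar>C\<bar> \<le> \<bar>Im u\<bar> * \<bar>C\<bar>" using b by (simp flip: abs_mult)
  then have "1 \<le> \<bar>Im u\<bar>" using C by simp
  then have "1 \<le> (Im u)\<^sup>2" by (simp add: abs_square_less_1 linorder_not_less[symmetric])
  moreover have "(Re u)\<^sup>2 > 0" using a by simp
  ultimately show False using n by linarith
qed

text \<open>Only \<open>Im u1 > 0 > Im u2\<close> matters. Then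
  \<open>half_disc_map_sin_sign\<close> keeps the larger of \<open>t + lam\<close> and
  \<open>lam - t\<close> between \<open>lam\<close> and \<open>pi\<close>, where the map is at most
  11/50 by \<open>half_disc_map_small\<close>; the other value contributes at most 1.\<close>

lemma Im_half_disc_map_diff:
  assumes "5/2 * \<phi> \<le> lam" "lam < pi" "norm z = 1"
  shows "Im (half_disc_map \<phi> (z * cis lam)) - Im (half_disc_map \<phi> (z * cis (- lam))) \<le> 61/50"
proof -
  define t where "t = Arg z"
  have t: "-pi < t" "t \<le> pi" using mpi_less_Arg Arg_le_pi by (auto simp: t_def)
  have z: "z = cis t" using assms(3) cis_Arg[of z] by (cases "z = 0") (auto simp: t_def sgn_div_norm)
  define u1 u2 where "u1 = half_disc_map \<phi> (cis (t + lam))" and "u2 = half_disc_map \<phi> (cis (t - lam))"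
  have n: "norm u1 \<le> 1" "norm u2 \<le> 1"
    using half_disc_map_sphere(2) by (auto simp: u1_def u2_def)
  have i: "Im u1 \<le> 1" "- Im u2 \<le> 1" using n abs_Im_le_cmod[of u1] abs_Im_le_cmod[of u2] by auto
  have key: "5/2 * (sin (\<phi>/2) * \<bar>cos h\<bar>) \<le> cos (\<phi>/2) * \<bar>sin h\<bar>"
    if "lam/2 \<le> h" "h < pi/2" for h
  proof -
    have "cos h > 0" "sin h > 0" using that assms \<phi> by (auto intro!: cos_gt_zero_pi sin_gt_zero)
    moreover have "5/2 * tan (\<phi>/2) \<le> tan h" by (rule tan_five_halves) (use that assms \<phi> in auto)
    ultimately show ?thesis using cs_pos by (simp add: tan_def field_simps)
  qed
  have "Im u1 - Im u2 \<le> 61/50"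
  proof (cases "Im u1 \<le> 0 \<or> Im u2 \<ge> 0")
    case True
    then show ?thesis using i by auto
  next
    case False
    then have s: "sin (t + lam) > 0" "sin (t - lam) < 0"
      using half_disc_map_sin_sign unfolding u1_def u2_def by auto
    show ?thesis
    proof (cases "t \<ge> 0")
      case True
      have "t + lam < pi"
      proof (rule ccontr)
        assume "\<not> t + lam < pi"
        then have "sin (t + lam - pi) \<ge> 0" using t assms by (intro sin_ge_zero) auto
        then show False using s(1) by (simp add: sin_diff)
      qed
      then have "norm u1 \<le> 11/50"
        unfolding u1_def by (intro half_disc_map_small key) (use True in auto)
      then show ?thesis using i abs_Im_le_cmod[of u1] by auto
    next
      case False
      have "lam - t < pi"
      proof (rule ccontr)
        assume "\<not> lam - t < pi"
        then have "sin (lam - t - pi) \<ge> 0" using t assms by (intro sin_ge_zero) auto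
        moreover have "sin (lam - t - pi) = sin (t - lam)" by (simp add: sin_diff)
        ultimately show False using s(2) by simp
      qed
      then have "5/2 * (sin (\<phi>/2) * \<bar>cos ((lam - t)/2)\<bar>) \<le> cos (\<phi>/2) * \<bar>sin ((lam - t)/2)\<bar>"
        by (intro key) (use False in auto)
      moreover have "(t - lam)/2 = - ((lam - t)/2)" by argo
      ultimately have "norm u2 \<le> 11/50"
        unfolding u2_def by (intro half_disc_map_small) (simp only: cos_minus sin_minus abs_minus_cancel)
      then show ?thesis using i abs_Im_le_cmod[of u2] by auto
    qed
  qed
  then show ?thesis by (simp add: u1_def u2_def z cis_mult)
qed

end

section \<open>Smoothed indicator functions of arcs\<close>

text \<open>\<open>z F'\<close> is a multiple of the difference of two rotated copies of
  \<open>K = u / u0\<close>, one for each end of the enlarged arc of half-angle \<open>lam\<close>.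
  \<open>A\<close> is the largest factor for which the bound 61/50 of
  \<open>Im_half_disc_map_diff\<close> yields \<open>Re (z F') <= 1/2\<close>. The share of the
  enlarged arc in the circle is \<open>lam / pi\<close>.\<close>

lemma two_end_certificate:
  assumes \<phi>: "0 < \<phi>" and l: "0 \<le> l"
  defines "lam \<equiv> pi * l + \<phi>"
  assumes lam: "5/2 * \<phi> \<le> lam" "lam < pi"
  defines "A \<equiv> 50/61 * pi * (sin (\<phi>/2) / (1 + cos (\<phi>/2)))"
  obtains F where "F holomorphic_on ball 0 1" "F 0 = 0"
    "\<And>z. z \<in> ball 0 1 \<Longrightarrow> Re (z * deriv F z) \<le> 1/2"
    "\<And>t e. \<bar>t\<bar> \<le> pi * l \<Longrightarrow> e > 0 \<Longrightarrow>
        eventually (\<lambda>r. Re (F (of_real r * cis t)) \<ge> A + - (A * lam / pi) - e) (at_left 1)"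
    "\<And>t e. e > 0 \<Longrightarrow> eventually (\<lambda>r. Re (F (of_real r * cis t)) \<ge> - (A * lam / pi) - e) (at_left 1)"
proof -
  have \<phi>': "\<phi> < pi" using lam \<phi> by auto
  note \<phi>2 = \<phi> \<phi>'
  define u0 where "u0 = sin (\<phi>/2) / (1 + cos (\<phi>/2))"
  have "sin (\<phi>/2) > 0" "cos (\<phi>/2) > 0" using \<phi> \<phi>' by (auto intro!: sin_gt_zero cos_gt_zero_pi)
  then have u0: "u0 > 0" by (simp add: u0_def)
  have A1: "A = 50/61 * pi * u0" by (simp add: A_def u0_def)
  moreover have "A > 0" unfolding A1 using u0 by simp
  ultimately have A: "A = 50/61 * pi * u0" "A > 0" by auto
  define K where "K z = half_disc_map \<phi> z / of_real u0" for z
  have K0: "K 0 = 1" using u0 half_disc_map_0[OF \<phi>2, folded u0_def] by (simp add: K_def)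
  have holK: "K holomorphic_on ball 0 1"
    unfolding K_def using u0 by (intro holomorphic_intros holomorphic_on_half_disc_map \<phi>2) auto
  have contK: "continuous_on (cball 0 1) K"
    unfolding K_def using u0 by (intro continuous_intros continuous_on_half_disc_map \<phi>2) auto
  have ReK: "Re (K z) \<ge> 0" if "norm z < 1" for z
    using half_disc_map_ball(1)[OF \<phi>2 that] u0 by (simp add: K_def)
  \<comment> \<open>Since \<open>K - 1\<close> vanishes at 0, its quotient by \<open>z\<close> is
    holomorphic; the primitive \<Psi> of this quotient yields both \<open>F\<close> and the
    distribution function of the kernel.\<close>
  define h where "h z = (if z = 0 then deriv (\<lambda>z. K z - 1) 0 else (K z - 1) / z)" for z
  have holh: "h holomorphic_on ball 0 1"
  proof (rule pole_theorem_0[where a = 0 and g = "\<lambda>z. K z - 1"])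
    show "(\<lambda>z. K z - 1) holomorphic_on ball 0 1" by (intro holomorphic_intros holK)
  qed (auto simp: h_def K0)
  have zh: "z * h z = K z - 1" for z by (simp add: h_def K0)
  obtain \<Psi> where "\<And>x. x \<in> ball 0 1 \<Longrightarrow> (\<Psi> has_field_derivative h x) (at x within ball 0 1)"
    using holomorphic_convex_primitive'[OF _ _ holh] by auto
  then have d\<Psi>: "(\<Psi> has_field_derivative h x) (at x)" if "norm x < 1" for x
    using that at_within_open[of x "ball 0 1"] by fastforce
  have rot: "norm (z * cis a) < 1" if "norm z < 1" for z a using that by (simp add: norm_mult)
  define k :: complex where "k = - \<i> * of_real (A / (2 * pi))"
  define F where "F z = k * (\<Psi> (z * cis lam) - \<Psi> (z * cis (- lam)))" for z
  define N where "N z = k * (K (z * cis lam) - K (z * cis (- lam)))" for z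
  have dF: "(F has_field_derivative k * (h (z * cis lam) * cis lam - h (z * cis (- lam)) * cis (- lam))) (at z)"
    if "norm z < 1" for z
    unfolding F_def
    by (intro DERIV_cmult DERIV_diff DERIV_chain2[OF d\<Psi>] rot that)
       (auto intro!: derivative_eq_intros)
  have holF: "F holomorphic_on ball 0 1"
    using dF by (subst holomorphic_on_open, simp) (metis mem_ball_0)
  have zF: "z * deriv F z = N z" if "norm z < 1" for z
  proof -
    have "z * deriv F z = k * ((z * cis lam) * h (z * cis lam) - (z * cis (- lam)) * h (z * cis (- lam)))"
      unfolding DERIV_imp_deriv[OF dF[OF that]] by (simp add: algebra_simps)
    then show ?thesis unfolding zh N_def by simp
  qed
  have pos: "Re (z * deriv F z) \<le> 1/2" if "z \<in> ball 0 1" for z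
  proof -
    \<comment> \<open>By the maximum principle the density condition has to be checked only on the
      unit circle, up to which \<open>K\<close> is continuous.\<close>
    have "Re (N z) \<le> 1/2"
    proof (rule maximum_real_frontier[where S = "ball 0 1" and f = N])
      show "N holomorphic_on interior (ball 0 1)"
      proof -
        have "(\<lambda>z. K (z * cis a)) holomorphic_on ball 0 1" for a
          by (rule holomorphic_on_compose_gen[of "\<lambda>z. z * cis a" _ K "ball 0 1", unfolded o_def])
             (auto intro!: holomorphic_intros holK rot)
        then show ?thesis unfolding N_def by (auto intro!: holomorphic_intros)
      qed
      show "continuous_on (closure (ball 0 1)) N"
        unfolding N_def
        by (auto intro!: continuous_intros continuous_on_compose2[OF contK] simp: norm_mult)
      show "Re (N z) \<le> 1/2" if "z \<in> frontier (ball 0 1)" for z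
      proof -
        have z: "norm z = 1" using that by (simp add: sphere_def)
        have "Re (N z) = A / (2 * pi * u0) * (Im (half_disc_map \<phi> (z * cis lam)) - Im (half_disc_map \<phi> (z * cis (- lam))))"
          using u0 by (simp add: N_def k_def K_def field_simps)
        also have "\<dots> \<le> A / (2 * pi * u0) * (61/50)"
          by (intro mult_left_mono Im_half_disc_map_diff \<phi>2 lam z) (use A u0 in auto)
        also have "\<dots> = 1/2" using u0 by (simp add: A)
        finally show ?thesis .
      qed
    qed (use that in auto)
    then show ?thesis using zF that by simp
  qed
  \<comment> \<open>\<open>V r\<close> is a distribution function of the smoothing kernel \<open>Re K\<close> on the circle of radius \<open>r\<close>.\<close>
  define V where "V r s = Im (\<Psi> (of_real r * cis s)) + s" for r s :: real
  have dV: "(V r has_real_derivative Re (K (of_real r * cis s))) (at s)" if r: "0 \<le> r" "r < 1" for r s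
  proof -
    have n: "norm (of_real r * cis s) < 1" using r by (simp add: norm_mult)
    have dw: "((\<lambda>s. of_real r * cis s) has_vector_derivative \<i> * (of_real r * cis s)) (at s)"
      unfolding has_vector_derivative_def
      by (auto intro!: derivative_eq_intros simp: algebra_simps scaleR_conv_of_real)
    have "((\<lambda>s. \<Psi> (of_real r * cis s)) has_vector_derivative \<i> * (of_real r * cis s) * h (of_real r * cis s)) (at s)"
      using field_vector_diff_chain_at[OF dw d\<Psi>[OF n]] by (simp add: o_def)
    then have "((\<lambda>s. \<Psi> (of_real r * cis s)) has_vector_derivative \<i> * (K (of_real r * cis s) - 1)) (at s)"
      by (simp only: mult.assoc zh)
    from bounded_linear.has_vector_derivative[OF bounded_linear_Im this]
    have "((\<lambda>s. Im (\<Psi> (of_real r * cis s))) has_real_derivative Re (K (of_real r * cis s)) - 1) (at s)"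
      by (simp add: has_real_derivative_iff_has_vector_derivative)
    from DERIV_add[OF this DERIV_ident] show ?thesis unfolding V_def by simp
  qed
  have V_mono: "V r s \<le> V r s'" if "0 \<le> r" "r < 1" "s \<le> s'" for r s s'
    using that dV ReK by (intro DERIV_nonneg_imp_nondecreasing[OF \<open>s \<le> s'\<close>]) (fastforce simp: norm_mult)
  have ReF: "Re (F (of_real r * cis t)) = A / (2 * pi) * (V r (t + lam) - V r (t - lam)) - A * lam / pi" for r t
  proof -
    have e: "of_real r * cis t * cis lam = of_real r * cis (t + lam)"
      "of_real r * cis t * cis (- lam) = of_real r * cis (t - lam)"
      by (simp_all add: cis_mult mult.assoc)
    show ?thesis unfolding F_def V_def k_def e by (simp add: field_simps)
  qed
  have low: "Re (F (of_real r * cis t)) \<ge> - (A * lam / pi)" if "0 < r" "r < 1" for r t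
  proof -
    have "V r (t - lam) \<le> V r (t + lam)" using that lam \<phi> by (intro V_mono) auto
    then show ?thesis unfolding ReF using A(2) by simp
  qed
  have high: "eventually (\<lambda>r. Re (F (of_real r * cis t)) \<ge> A + - (A * lam / pi) - e) (at_left 1)"
    if t: "\<bar>t\<bar> \<le> pi * l" and e: "e > 0" for t e
  proof -
    define \<epsilon> where "\<epsilon> = e / A"
    have \<epsilon>: "\<epsilon> > 0" using e A by (simp add: \<epsilon>_def)
    have "uniformly_continuous_on (cball 0 1) K" by (intro compact_uniformly_continuous contK) auto
    then obtain \<delta> where \<delta>: "\<delta> > 0"
      "\<And>x y. x \<in> cball 0 1 \<Longrightarrow> y \<in> cball 0 1 \<Longrightarrow> dist y x < \<delta> \<Longrightarrow> dist (K y) (K x) < \<epsilon>"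
      unfolding uniformly_continuous_on_def using \<epsilon> by metis
    have "eventually (\<lambda>r::real. 1 - \<delta> < r) (at_left 1)"
      using \<delta>(1) eventually_at_left_real[of "1 - \<delta>" 1] by (auto elim: eventually_mono)
    then show ?thesis using eventually_at_left_1_unit
    proof eventually_elim
      case (elim r)
      have small: "Re (K (of_real r * cis s)) \<le> \<epsilon>" if s: "\<phi> \<le> s" "s \<le> 2 * pi - \<phi>" for s
      proof -
        have "dist (of_real r * cis s) (cis s) = norm (of_real (r - 1) * cis s)"
          by (simp add: dist_norm algebra_simps)
        also have "\<dots> = 1 - r" using elim by (simp only: norm_mult norm_of_real norm_cis) simp
        finally have "dist (K (of_real r * cis s)) (K (cis s)) < \<epsilon>"
          using elim by (intro \<delta>(2)) (auto simp: norm_mult)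
        moreover have "Re (K (cis s)) = 0" using half_disc_map_Re_0[OF \<phi>2 s] by (simp add: K_def)
        ultimately show ?thesis using abs_Re_le_cmod[of "K (of_real r * cis s) - K (cis s)"] by (simp add: dist_norm)
      qed
      \<comment> \<open>Between \<phi> and \<open>2 * pi - \<phi>\<close> the slope of
        \<open>V r\<close> is at most \<epsilon>, while its increase over a period is
        \<open>2 * pi\<close>. So almost all of the increase happens on
        \<open>[-\<phi>, \<phi>]\<close>, which lies in \<open>[t - lam, t + lam]\<close>; the
        choice \<open>\<epsilon> = e / A\<close> limits the loss to \<open>e\<close>.\<close>
      have "\<epsilon> * \<phi> - V r \<phi> \<le> \<epsilon> * (2 * pi - \<phi>) - V r (2 * pi - \<phi>)"
      proof (rule DERIV_nonneg_imp_nondecreasing[where f = "\<lambda>s. \<epsilon> * s - V r s"])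
        show "\<phi> \<le> 2 * pi - \<phi>" using \<phi>2 by simp
        fix s assume "\<phi> \<le> s" "s \<le> 2 * pi - \<phi>"
        then show "\<exists>y. ((\<lambda>s. \<epsilon> * s - V r s) has_real_derivative y) (at s) \<and> 0 \<le> y"
          using dV[of r s] elim small
          by (intro exI[of _ "\<epsilon> - Re (K (of_real r * cis s))"]) (auto intro!: derivative_eq_intros)
      qed
      moreover have "V r (2 * pi - \<phi>) = V r (- \<phi>) + 2 * pi"
        by (simp add: V_def cis.ctr sin_diff cos_diff)
      ultimately have "2 * pi - \<epsilon> * (2 * pi - 2 * \<phi>) \<le> V r \<phi> - V r (- \<phi>)" by (simp add: algebra_simps)
      moreover have "\<epsilon> * (2 * pi - 2 * \<phi>) \<le> \<epsilon> * (2 * pi)" using \<epsilon> \<phi> by simp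
      moreover have "V r \<phi> \<le> V r (t + lam)" "V r (t - lam) \<le> V r (- \<phi>)"
        using t elim by (auto intro!: V_mono simp: lam_def)
      ultimately have "2 * pi - \<epsilon> * (2 * pi) \<le> V r (t + lam) - V r (t - lam)" by linarith
      then have "A / (2 * pi) * (2 * pi - \<epsilon> * (2 * pi)) \<le> A / (2 * pi) * (V r (t + lam) - V r (t - lam))"
        using A(2) by (intro mult_left_mono) auto
      moreover have "A / (2 * pi) * (2 * pi - \<epsilon> * (2 * pi)) = A - e"
        using A(2) by (simp add: \<epsilon>_def right_diff_distrib)
      ultimately show ?case unfolding ReF by linarith
    qed
  qed
  show thesis
  proof (rule that[OF holF _ pos high])
    show "F 0 = 0" by (simp add: F_def)
    fix t e :: real assume "e > 0"
    show "eventually (\<lambda>r. Re (F (of_real r * cis t)) \<ge> - (A * lam / pi) - e) (at_left 1)"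
      using eventually_at_left_1_unit
    proof eventually_elim
      case (elim r)
      then show ?case using low[of r t] \<open>e > 0\<close> by linarith
    qed
  qed auto
qed

section \<open>Excess of points on an arc\<close>

text \<open>There are finitely many points, so one radius \<open>r\<close> close to 1 serves all of
  them, and \<open>ln_potential_bound\<close> applies at this radius.\<close>

lemma arc_certificate_bound:
  assumes F: "F holomorphic_on ball 0 1" "F 0 = 0"
      "\<And>z. z \<in> ball 0 1 \<Longrightarrow> Re (z * deriv F z) \<le> 1/2"
    and hi: "\<And>t e. \<bar>t\<bar> \<le> pi * l \<Longrightarrow> e > 0 \<Longrightarrow>
        eventually (\<lambda>r. Re (F (of_real r * cis t)) \<ge> A + b - e) (at_left 1)"
    and lo: "\<And>t e. e > 0 \<Longrightarrow> eventually (\<lambda>r. Re (F (of_real r * cis t)) \<ge> b - e) (at_left 1)"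
    and Z: "finite Z" "\<And>x. x \<in> Z \<Longrightarrow> norm (\<zeta> x) = 1"
    and M: "\<And>w. norm w < 1 \<Longrightarrow> (\<Prod>x\<in>Z. norm (w - \<zeta> x) ^ k x) \<le> M"
  shows "A * (\<Sum>x | x \<in> Z \<and> \<zeta> x \<in> cis ` {-(pi * l)..pi * l}. real (k x)) + b * (\<Sum>x\<in>Z. real (k x)) \<le> ln M"
proof (rule field_le_epsilon)
  fix e0 :: real assume e0: "e0 > 0"
  define S where "S = (\<Sum>x\<in>Z. real (k x))"
  have S: "S \<ge> 0" by (simp add: S_def sum_nonneg)
  define e where "e = e0 / (S + 1)"
  have e: "e > 0" using e0 S by (simp add: e_def)
  have "e * S \<le> e0" using e0 S by (simp add: e_def field_simps)
  let ?I = "cis ` {-(pi * l)..pi * l}"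
  let ?b = "\<lambda>x. b + (if \<zeta> x \<in> ?I then A else 0)"
  have "eventually (\<lambda>r. Re (F (of_real r * \<zeta> x)) \<ge> ?b x - e) (at_left 1)" if x: "x \<in> Z" for x
  proof (cases "\<zeta> x \<in> ?I")
    case True
    then obtain t where "\<zeta> x = cis t" "\<bar>t\<bar> \<le> pi * l" by auto
    then show ?thesis using hi[of t e] e True by (auto simp: algebra_simps)
  next
    case False
    have "\<zeta> x = cis (Arg (\<zeta> x))" using Z(2)[OF x] cis_Arg[of "\<zeta> x"] by (cases "\<zeta> x = 0") (auto simp: sgn_div_norm)
    then show ?thesis using lo[OF e, of "Arg (\<zeta> x)"] False by auto
  qed
  then have "eventually (\<lambda>r. \<forall>x\<in>Z. Re (F (of_real r * \<zeta> x)) \<ge> ?b x - e) (at_left 1)"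
    using Z(1) by (simp add: eventually_ball_finite_distrib)
  then have "eventually (\<lambda>r. (\<forall>x\<in>Z. Re (F (of_real r * \<zeta> x)) \<ge> ?b x - e) \<and> 0 < r \<and> r < 1) (at_left 1)"
    using eventually_at_left_1_unit by eventually_elim auto
  then obtain r where r: "\<And>x. x \<in> Z \<Longrightarrow> Re (F (of_real r * \<zeta> x)) \<ge> ?b x - e" "0 < r" "r < 1"
    using eventually_happens'[OF trivial_limit_at_left_real] by blast
  have "(\<Sum>x\<in>Z. real (k x) * (?b x - e)) \<le> (\<Sum>x\<in>Z. real (k x) * Re (F (of_real r * \<zeta> x)))"
    by (intro sum_mono mult_left_mono r) auto
  also have "\<dots> \<le> ln M" by (rule ln_potential_bound[OF F Z M]) (use r in auto)
  finally have "(\<Sum>x\<in>Z. real (k x) * (?b x - e)) \<le> ln M" .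
  moreover have "(\<Sum>x\<in>Z. real (k x) * (?b x - e)) =
      (\<Sum>x\<in>Z. real (k x) * (if \<zeta> x \<in> ?I then A else 0)) + b * S - e * S"
    by (simp add: S_def sum_distrib_left algebra_simps sum.distrib sum_subtractf)
  moreover have "(\<Sum>x\<in>Z. real (k x) * (if \<zeta> x \<in> ?I then A else 0)) = A * (\<Sum>x | x \<in> Z \<and> \<zeta> x \<in> ?I. real (k x))"
    by (simp add: sum_distrib_left if_distrib mult.commute sum.inter_filter[OF Z(1)] cong: if_cong)
  ultimately show "A * (\<Sum>x | x \<in> Z \<and> \<zeta> x \<in> ?I. real (k x)) + b * (\<Sum>x\<in>Z. real (k x)) \<le> ln M + e0"
    using \<open>e * S \<le> e0\<close> unfolding S_def[symmetric] by linarith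
qed

text \<open>From \<open>cos (pi l / 2) >= 1 - y\<close> with
  \<open>y = (pi l)\<^sup>2 / 8 <= 23/100\<close>, and \<open>- ln (1 - y) <= y / (1 - y)\<close>.
  The constants 3/7 and 11/6 are those required by the short arcs in
  \<open>arc_excess_bound\<close>.\<close>

lemma ln_cos_lower_bound:
  assumes "0 \<le> l" "l \<le> 3/7"
  shows "ln (cos (pi * l / 2)) \<ge> - 11/6 * l\<^sup>2"
proof -
  define y where "y = (pi * l)\<^sup>2 / 8"
  have "cos (pi * l / 2) = 1 - 2 * (sin (pi * l / 4))\<^sup>2"
    using cos_double_sin[of "pi * l / 4"] by simp
  moreover have "(sin (pi * l / 4))\<^sup>2 \<le> (pi * l / 4)\<^sup>2"
    using abs_sin_x_le_abs_x[of "pi * l / 4"] by (simp only: abs_le_square_iff)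
  ultimately have c: "cos (pi * l / 2) \<ge> 1 - y" by (simp add: y_def power_divide)
  have "pi\<^sup>2 \<le> (63/20)\<^sup>2" using pi_approx by (intro power_mono) auto
  then have "pi\<^sup>2 * l\<^sup>2 \<le> (63/20)\<^sup>2 * l\<^sup>2" by (intro mult_right_mono) auto
  then have y1: "y \<le> 3969/3200 * l\<^sup>2" by (simp add: y_def power_mult_distrib power_divide)
  have "l\<^sup>2 \<le> (3/7)\<^sup>2" using assms by (intro power_mono) auto
  then have y2: "y \<le> 23/100" using y1 by (simp add: power_divide)
  have y0: "y \<ge> 0" by (simp add: y_def)
  have "ln (1 / (1 - y)) \<le> 1 / (1 - y) - 1" using y2 by (intro ln_le_minus_one) auto
  also have "\<dots> = y / (1 - y)" using y2 by (simp add: field_simps)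
  also have "\<dots> \<le> y / (77/100)" using y0 y2 by (intro divide_left_mono) auto
  also have "\<dots> = 100/77 * y" by simp
  also have "\<dots> \<le> 11/6 * l\<^sup>2" using y1 zero_le_power2[of l] by linarith
  finally have "- ln (1 - y) \<le> 11/6 * l\<^sup>2" using y2 by (simp add: ln_div)
  moreover have "ln (1 - y) \<le> ln (cos (pi * l / 2))"
    using c y2 by (subst ln_le_cancel_iff) auto
  ultimately show ?thesis by simp
qed

text \<open>Arcs that are short compared with their excess \<open>d\<close> are handled by the
  equilibrium measure, the others by the smoothed indicator function.\<close>

lemma arc_excess_bound:
  assumes Z: "finite Z" "\<And>x. x \<in> Z \<Longrightarrow> norm (\<zeta> x) = 1"
    and M: "\<And>w. norm w < 1 \<Longrightarrow> (\<Prod>x\<in>Z. norm (w - \<zeta> x) ^ k x) \<le> M"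
    and l: "0 \<le> l" and d: "d > 0"
    and n: "n = (\<Sum>x\<in>Z. real (k x))" "n > 0"
    and cnt: "(\<Sum>x | x \<in> Z \<and> \<zeta> x \<in> cis ` {-(pi * l)..pi * l}. real (k x)) = n * (l + d)"
  shows "n * d\<^sup>2 / 2 \<le> ln M"
proof -
  have "n * (l + d) \<le> n * 1"
    unfolding cnt[symmetric] unfolding n(1) by (auto intro!: sum_mono2 Z)
  then have ld: "l + d \<le> 1" using n(2) by simp
  show ?thesis
  proof (cases "l \<le> 3/4 * d")
    case True
    \<comment> \<open>This \<open>u\<close> maximises \<open>u (l + d) - u\<^sup>2 / 2\<close>. The
      bound 3/7 below follows from \<open>l <= 3/4 d\<close> and \<open>l + d <= 1\<close>.\<close>
    define u where "u = l + d"
    have l1: "l < 1" "l \<le> 3/7" using ld d True by auto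
    have u: "u > 0" using l d by (simp add: u_def)
    let ?c = "cos (pi * l / 2) * exp (- (u\<^sup>2) / 2)"
    obtain F where F: "F holomorphic_on ball 0 1" "F 0 = 0"
      "\<And>z. z \<in> ball 0 1 \<Longrightarrow> Re (z * deriv F z) \<le> 1/2"
      "\<And>t e. \<bar>t\<bar> \<le> pi * l \<Longrightarrow> e > 0 \<Longrightarrow> eventually (\<lambda>r. Re (F (of_real r * cis t)) \<ge> u + ln ?c - e) (at_left 1)"
      "\<And>t e. e > 0 \<Longrightarrow> eventually (\<lambda>r. Re (F (of_real r * cis t)) \<ge> ln ?c - e) (at_left 1)"
      by (rule one_gap_certificate[OF l l1(1) u]) (rule that)
    have "u * (\<Sum>x | x \<in> Z \<and> \<zeta> x \<in> cis ` {-(pi * l)..pi * l}. real (k x)) + ln ?c * (\<Sum>x\<in>Z. real (k x)) \<le> ln M"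
      by (rule arc_certificate_bound[where l = l and A = u and b = "ln ?c"]) (fact F Z M)+
    then have "u * (n * u) + ln ?c * n \<le> ln M"
      unfolding cnt n(1)[symmetric] u_def[symmetric] .
    note H = this
    have "cos (pi * l / 2) > 0"
      using l l1 by (intro cos_gt_zero_pi) (auto intro: order_less_le_trans[of _ 0])
    then have "ln ?c = ln (cos (pi * l / 2)) - u\<^sup>2 / 2" by (simp add: ln_mult)
    from H[unfolded this] have "n * (u\<^sup>2 / 2 + ln (cos (pi * l / 2))) \<le> ln M"
      by (simp add: algebra_simps power2_eq_square)
    moreover have "d\<^sup>2 / 2 \<le> u\<^sup>2 / 2 + ln (cos (pi * l / 2))"
    proof -
      \<comment> \<open>Here \<open>u\<^sup>2 / 2 - d\<^sup>2 / 2 = l\<^sup>2 / 2 + l d\<close>,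
        which is at least \<open>(1/2 + 4/3) l\<^sup>2 = 11/6 l\<^sup>2\<close>.\<close>
      have "l * (4/3 * l) \<le> l * d" using True l by (intro mult_left_mono) auto
      then have "11/6 * l\<^sup>2 \<le> u\<^sup>2 / 2 - d\<^sup>2 / 2" by (simp add: u_def power2_eq_square algebra_simps)
      then show ?thesis using ln_cos_lower_bound[OF l l1(2)] by linarith
    qed
    then have "n * (d\<^sup>2 / 2) \<le> n * (u\<^sup>2 / 2 + ln (cos (pi * l / 2)))" using n(2) by (intro mult_left_mono) auto
    ultimately show ?thesis by simp
  next
    case False
    \<comment> \<open>The arc is enlarged at each end by \<open>d/4\<close> of the full circle. The
      condition \<open>5/2 \<phi> <= lam\<close> then amounts to \<open>l >= 3/4 d\<close>, which
      explains where the cases split.\<close>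
    define \<phi> where "\<phi> = pi * d / 2"
    define lam where "lam = pi * l + \<phi>"
    define A where "A = 50/61 * pi * (sin (\<phi>/2) / (1 + cos (\<phi>/2)))"
    have \<phi>: "\<phi> > 0" using d by (simp add: \<phi>_def)
    have "pi * (3/4 * d) \<le> pi * l" using False by (intro mult_left_mono) auto
    then have lam1: "5/2 * \<phi> \<le> lam" by (simp add: lam_def \<phi>_def)
    have "pi * (l + d/2) < pi * 1" using ld d by (intro mult_strict_left_mono) auto
    then have lam2: "lam < pi" by (simp add: lam_def \<phi>_def algebra_simps)
    obtain F where F: "F holomorphic_on ball 0 1" "F 0 = 0"
      "\<And>z. z \<in> ball 0 1 \<Longrightarrow> Re (z * deriv F z) \<le> 1/2"
      "\<And>t e. \<bar>t\<bar> \<le> pi * l \<Longrightarrow> e > 0 \<Longrightarrow>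
          eventually (\<lambda>r. Re (F (of_real r * cis t)) \<ge> A + - (A * lam / pi) - e) (at_left 1)"
      "\<And>t e. e > 0 \<Longrightarrow> eventually (\<lambda>r. Re (F (of_real r * cis t)) \<ge> - (A * lam / pi) - e) (at_left 1)"
      by (rule two_end_certificate[OF \<phi> l, folded lam_def A_def, OF lam1 lam2]) (rule that)
    have "A * (\<Sum>x | x \<in> Z \<and> \<zeta> x \<in> cis ` {-(pi * l)..pi * l}. real (k x)) + - (A * lam / pi) * (\<Sum>x\<in>Z. real (k x)) \<le> ln M"
      by (rule arc_certificate_bound[where l = l and A = A]) (fact F Z M)+
    then have "A * (n * (l + d)) + - (A * lam / pi) * n \<le> ln M"
      unfolding cnt n(1)[symmetric] .
    moreover have "lam / pi = l + d/2" by (simp add: lam_def \<phi>_def add_divide_distrib)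
    then have "A * lam / pi = A * (l + d/2)" by (metis times_divide_eq_right)
    ultimately have *: "n * (A * d / 2) \<le> ln M" by (simp add: algebra_simps)
    \<comment> \<open>The margin is narrow: \<open>tan (\<phi>/4) >= \<phi>/4\<close> leaves the
      factor \<open>25/244 pi\<^sup>2\<close>, and
      \<open>25/244 (25/8)\<^sup>2 = 15625/15616\<close>.\<close>
    have "d \<le> A"
    proof -
      have q: "\<phi>/4 < pi/2" "\<phi>/4 > 0" using lam1 lam2 \<phi> by auto
      have "sin (\<phi>/2) / (1 + cos (\<phi>/2)) = tan (\<phi>/4)" using tan_half[of "\<phi>/4"] by (simp add: add.commute)
      moreover have "tan (\<phi>/4) \<ge> \<phi>/4" using abs_tan_ge[of "\<phi>/4"] tan_gt_zero[of "\<phi>/4"] q by simp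
      ultimately have "A \<ge> 50/61 * pi * (\<phi>/4)" unfolding A_def by (intro mult_left_mono) auto
      moreover have "50/61 * pi * (\<phi>/4) = 25/244 * pi\<^sup>2 * d" by (simp add: \<phi>_def power2_eq_square)
      moreover have "pi\<^sup>2 \<ge> (25/8)\<^sup>2" using pi_approx by (intro power_mono) auto
      then have "25/244 * pi\<^sup>2 \<ge> 1" by (simp add: power_divide)
      then have "25/244 * pi\<^sup>2 * d \<ge> 1 * d" using d by (intro mult_right_mono) auto
      ultimately show ?thesis by linarith
    qed
    then have "d * d / 2 \<le> A * d / 2" using d by simp
    then have "n * (d * d / 2) \<le> n * (A * d / 2)" using n(2) by (intro mult_left_mono) auto
    then show ?thesis using * by (simp add: power2_eq_square)
  qed
qed

section \<open>The upper bound\<close>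

text \<open>For unimodular \<open>w\<close> and \<zeta> one has \<open>|w - r \<zeta>|\<^sup>2 = r
  |w - \<zeta>|\<^sup>2 + (1 - r)\<^sup>2\<close>.\<close>

lemma norm_diff_sgn_le:
  fixes w z :: complex
  assumes "norm w = 1" "z \<noteq> 0"
  shows "sqrt (norm z) * norm (w - sgn z) \<le> norm (w - z)"
proof (rule power2_le_imp_le)
  define r \<zeta> where "r = norm z" and "\<zeta> = sgn z"
  have z: "z = of_real r * \<zeta>" using assms by (simp add: r_def \<zeta>_def sgn_div_norm scaleR_conv_of_real)
  have r: "r > 0" using assms by (simp add: r_def)
  have w1: "Re w * Re w + Im w * Im w = 1" using assms by (simp add: cmod_def power2_eq_square)
  have "norm \<zeta> = 1" using assms by (simp add: \<zeta>_def norm_sgn)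
  then have z1: "Re \<zeta> * Re \<zeta> + Im \<zeta> * Im \<zeta> = 1" by (simp add: cmod_def power2_eq_square)
  have "(sqrt r * norm (w - \<zeta>))\<^sup>2 = r * ((Re w - Re \<zeta>)\<^sup>2 + (Im w - Im \<zeta>)\<^sup>2)"
    using r by (simp add: power_mult_distrib cmod_power2)
  moreover have "(norm (w - z))\<^sup>2 = (Re w - r * Re \<zeta>)\<^sup>2 + (Im w - r * Im \<zeta>)\<^sup>2"
    unfolding z by (simp add: cmod_power2)
  moreover have "(Re w - r * Re \<zeta>)\<^sup>2 + (Im w - r * Im \<zeta>)\<^sup>2
      = r * ((Re w - Re \<zeta>)\<^sup>2 + (Im w - Im \<zeta>)\<^sup>2) + (1 - r)\<^sup>2"
    using w1 z1 by algebra
  ultimately show "(sqrt (norm z) * norm (w - sgn z))\<^sup>2 \<le> (norm (w - z))\<^sup>2"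
    by (simp add: r_def \<zeta>_def)
qed auto

lemma norm_poly_eq_prod:
  fixes f :: "complex poly"
  shows "norm (poly f w) = norm (lead_coeff f) * (\<Prod>z | poly f z = 0. norm (w - z) ^ order z f)"
  by (subst complex_poly_decompose[of f, symmetric])
     (simp add: norm_mult poly_prod prod_norm[symmetric] norm_power)

definition height_max :: "complex poly \<Rightarrow> real" where
  "height_max f = Sup ((\<lambda>z. norm (poly f z)) ` sphere 0 1) / sqrt (norm (coeff f 0 * lead_coeff f))"

lemma height_eq: "height f = ln (height_max f) / real (degree f)"
  by (simp add: height_def height_max_def)

lemma sum_order_eq_degree:
  fixes f :: "complex poly"
  assumes "f \<noteq> 0" shows "(\<Sum>z | poly f z = 0. order z f) = degree f"
proof -
  have "degree f = degree (smult (lead_coeff f) (\<Prod>z | poly f z = 0. [:-z, 1:] ^ order z f))"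
    by (simp only: complex_poly_decompose)
  also have "\<dots> = (\<Sum>z | poly f z = 0. order z f)"
    using assms by (simp add: degree_prod_sum_eq degree_power_eq)
  finally show ?thesis by simp
qed

text \<open>The rotation moves the midpoint of the arc to 1; the angle becomes
  \<open>pi (2 q - (\<beta> - \<alpha>))\<close>, where \<open>q\<close> is the fractional part in
  \<open>on_arc\<close>.\<close>

lemma on_arc_imp_cis:
  assumes "z \<noteq> 0" "on_arc \<alpha> \<beta> (angle_frac z)"
  shows "sgn z * cis (- (pi * (\<alpha> + \<beta>))) \<in> cis ` {-(pi * (\<beta> - \<alpha>))..pi * (\<beta> - \<alpha>)}"
proof -
  define \<theta> where "\<theta> = angle_frac z"
  define q where "q = frac (\<theta> - \<alpha>)"
  define t where "t = pi * (2 * q - (\<beta> - \<alpha>))"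
  have q: "0 \<le> q" "q \<le> \<beta> - \<alpha>" using assms by (auto simp: q_def on_arc_def \<theta>_def)
  have "Arg z = 2 * pi * \<theta>" by (simp add: \<theta>_def angle_frac_def)
  moreover obtain m :: int where "\<theta> = \<alpha> + q + of_int m"
    using that[of "\<lfloor>\<theta> - \<alpha>\<rfloor>"] by (simp add: q_def frac_def)
  ultimately have a: "Arg z - pi * (\<alpha> + \<beta>) = t + 2 * pi * of_int m"
    by (simp add: t_def algebra_simps)
  have "sgn z * cis (- (pi * (\<alpha> + \<beta>))) = cis (Arg z - pi * (\<alpha> + \<beta>))"
    using assms(1) by (simp add: cis_Arg[symmetric] cis_mult)
  also have "\<dots> = cis t * cis (2 * pi * of_int m)" unfolding a by (simp only: cis_mult)
  also have "cis (2 * pi * of_int m) = 1" by (rule cis_multiple_2pi) simp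
  also have "cis t * 1 = cis t" by simp
  finally have e: "sgn z * cis (- (pi * (\<alpha> + \<beta>))) = cis t" .
  have "pi * (2 * q - (\<beta> - \<alpha>)) \<le> pi * (\<beta> - \<alpha>)" "pi * (- (\<beta> - \<alpha>)) \<le> pi * (2 * q - (\<beta> - \<alpha>))"
    using q by (intro mult_left_mono; simp)+
  then have "t \<in> {-(pi * (\<beta> - \<alpha>))..pi * (\<beta> - \<alpha>)}"
    by (simp only: t_def atLeastAtMost_iff mult_minus_right)
  then show ?thesis unfolding e by blast
qed

section \<open>Polynomials with their roots projected to the unit circle\<close>

context
  fixes f :: "complex poly"
  assumes deg: "degree f \<ge> 1" and f0: "poly f 0 \<noteq> 0"
begin

private lemma roots: "finite {z. poly f z = 0}" "f \<noteq> 0" "\<And>z. poly f z = 0 \<Longrightarrow> z \<noteq> 0"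
  using deg f0 by (auto intro!: poly_roots_finite)

text \<open>The factors \<open>sqrt |z|\<close> lost in \<open>norm_diff_sgn_le\<close> multiply,
  together with the leading coefficient, exactly to the normalisation \<open>sqrt |a_0 a_n|\<close>
  of the height.\<close>

lemma prod_sgn_le_height_max_sphere:
  assumes "norm w = 1"
  shows "(\<Prod>z | poly f z = 0. norm (w - sgn z) ^ order z f) \<le> height_max f"
proof -
  let ?Z = "{z. poly f z = 0}"
  have lc: "norm (lead_coeff f) > 0" using roots(2) by simp
  have c0: "norm (coeff f 0) = norm (lead_coeff f) * (\<Prod>z\<in>?Z. norm z ^ order z f)"
    using norm_poly_eq_prod[of f 0] by (simp add: poly_0_coeff_0)
  have "sqrt (norm (coeff f 0 * lead_coeff f)) = sqrt ((norm (lead_coeff f))\<^sup>2 * (\<Prod>z\<in>?Z. norm z ^ order z f))"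
    by (simp add: norm_mult c0 power2_eq_square mult_ac)
  also have "\<dots> = norm (lead_coeff f) * (\<Prod>z\<in>?Z. sqrt (norm z) ^ order z f)"
  proof -
    have "sqrt (\<Prod>z\<in>S. g z) = (\<Prod>z\<in>S. sqrt (g z))" for S and g :: "complex \<Rightarrow> real"
      by (induction S rule: infinite_finite_induct) (auto simp: real_sqrt_mult)
    then show ?thesis by (simp add: real_sqrt_mult real_sqrt_power)
  qed
  finally have s: "sqrt (norm (coeff f 0 * lead_coeff f)) = norm (lead_coeff f) * (\<Prod>z\<in>?Z. sqrt (norm z) ^ order z f)" .
  have spos: "sqrt (norm (coeff f 0 * lead_coeff f)) > 0"
    using roots f0 by (simp add: poly_0_coeff_0)
  have "(\<Prod>z\<in>?Z. norm (w - sgn z) ^ order z f) * sqrt (norm (coeff f 0 * lead_coeff f))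
      = norm (lead_coeff f) * (\<Prod>z\<in>?Z. (sqrt (norm z) * norm (w - sgn z)) ^ order z f)"
    unfolding s by (simp add: power_mult_distrib prod.distrib)
  also have "\<dots> \<le> norm (lead_coeff f) * (\<Prod>z\<in>?Z. norm (w - z) ^ order z f)"
    using roots assms by (intro mult_left_mono prod_mono conjI power_mono norm_diff_sgn_le zero_le_power) auto
  also have "\<dots> = norm (poly f w)" by (simp add: norm_poly_eq_prod)
  also have "\<dots> \<le> Sup ((\<lambda>z. norm (poly f z)) ` sphere 0 1)"
  proof (rule cSUP_upper)
    show "bdd_above ((\<lambda>z. norm (poly f z)) ` sphere 0 1)"
      by (intro bounded_imp_bdd_above compact_imp_bounded compact_continuous_image continuous_intros) auto
  qed (use assms in auto)
  finally show ?thesis unfolding height_max_def using spos by (simp add: pos_le_divide_eq)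
qed

lemma prod_sgn_le_height_max:
  assumes "norm w < 1"
  shows "(\<Prod>z | poly f z = 0. norm (w - sgn z) ^ order z f) \<le> height_max f"
proof -
  define g where "g w = (\<Prod>z | poly f z = 0. (w - sgn z) ^ order z f)" for w
  have n: "norm (g w) = (\<Prod>z | poly f z = 0. norm (w - sgn z) ^ order z f)" for w
    by (simp add: g_def prod_norm[symmetric] norm_power)
  have "norm (g w) \<le> height_max f"
  proof (rule maximum_modulus_frontier[where S = "ball 0 1" and f = g])
    show "g holomorphic_on interior (ball 0 1)" unfolding g_def by (intro holomorphic_intros)
    show "continuous_on (closure (ball 0 1)) g" unfolding g_def by (intro continuous_intros)
    show "norm (g z) \<le> height_max f" if "z \<in> frontier (ball 0 1)" for z
      unfolding n by (rule prod_sgn_le_height_max_sphere) (use that in auto)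
  qed (use assms in auto)
  then show ?thesis by (simp add: n)
qed

lemma height_max_ge_1: "height_max f \<ge> 1"
proof -
  have "(\<Prod>z | poly f z = 0. norm (0 - sgn z) ^ order z f) = 1"
    using roots(3) by (intro prod.neutral) (auto simp: norm_sgn)
  then show ?thesis using prod_sgn_le_height_max[of 0] by simp
qed

lemma height_nonneg: "height f \<ge> 0"
  using height_max_ge_1 by (simp add: height_eq)

lemma root_count_excess_le:
  assumes "\<alpha> \<le> \<beta>" "\<beta> < \<alpha> + 1"
  shows "real (root_count f \<alpha> \<beta>) / real (degree f) - (\<beta> - \<alpha>) \<le> sqrt 2 * sqrt (height f)"
proof -
  let ?Z = "{z. poly f z = 0}"
  define n where "n = real (degree f)"
  define l where "l = \<beta> - \<alpha>"
  define \<zeta> where "\<zeta> z = sgn z * cis (- (pi * (\<alpha> + \<beta>)))" for z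
  let ?A = "{z. z \<in> ?Z \<and> \<zeta> z \<in> cis ` {-(pi * l)..pi * l}}"
  \<comment> \<open>The excess is measured by the count over \<open>?A\<close>, which is at least
    \<open>root_count\<close>; this makes the counting hypothesis of \<open>arc_excess_bound\<close>
    an equality.\<close>
  define d where "d = (\<Sum>z\<in>?A. real (order z f)) / n - l"
  have n0: "n > 0" using deg by (simp add: n_def)
  have "root_count f \<alpha> \<beta> \<le> (\<Sum>z\<in>?A. order z f)"
    unfolding root_count_def using roots on_arc_imp_cis
    by (intro sum_mono2) (auto simp: \<zeta>_def l_def)
  then have "real (root_count f \<alpha> \<beta>) \<le> (\<Sum>z\<in>?A. real (order z f))"
    by (simp flip: of_nat_sum)
  then have "real (root_count f \<alpha> \<beta>) / n \<le> (\<Sum>z\<in>?A. real (order z f)) / n"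
    using n0 by (intro divide_right_mono) auto
  then have le: "real (root_count f \<alpha> \<beta>) / n - l \<le> d" by (simp add: d_def)
  have "d \<le> sqrt 2 * sqrt (height f)"
  proof (cases "d > 0")
    case False
    then show ?thesis using height_nonneg by (meson less_eq_real_def not_less order_trans mult_nonneg_nonneg real_sqrt_ge_zero zero_le_numeral)
  next
    case True
    have "n * d\<^sup>2 / 2 \<le> ln (height_max f)"
    proof (rule arc_excess_bound[where \<zeta> = \<zeta> and Z = ?Z and l = l and k = "\<lambda>z. order z f"])
      show "finite ?Z" by (rule roots)
      show "norm (\<zeta> z) = 1" if "z \<in> ?Z" for z
        using that roots(3) by (auto simp: \<zeta>_def norm_mult norm_sgn)
      show "n = (\<Sum>z\<in>?Z. real (order z f))"
        unfolding n_def sum_order_eq_degree[OF roots(2), symmetric] by simp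
      show "(\<Sum>z\<in>?A. real (order z f)) = n * (l + d)" using n0 by (simp add: d_def)
      show "(\<Prod>z\<in>?Z. norm (w - \<zeta> z) ^ order z f) \<le> height_max f" if "norm w < 1" for w
      proof -
        let ?c = "cis (pi * (\<alpha> + \<beta>))"
        have "norm (w - \<zeta> z) = norm (w * ?c - sgn z)" for z
        proof -
          have "norm (w - \<zeta> z) = norm ((w - \<zeta> z) * ?c)" by (simp add: norm_mult)
          also have "(w - \<zeta> z) * ?c = w * ?c - sgn z"
            by (simp add: \<zeta>_def left_diff_distrib mult.assoc cis_mult)
          finally show ?thesis .
        qed
        then show ?thesis using prod_sgn_le_height_max[of "w * ?c"] that by (simp add: norm_mult)
      qed
    qed (use assms True n0 in \<open>auto simp: l_def\<close>)
    then have "d\<^sup>2 / 2 \<le> height f" using n0 by (simp add: height_eq n_def[symmetric] field_simps)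
    then have "d\<^sup>2 \<le> 2 * height f" by simp
    then have "d \<le> sqrt (2 * height f)" by (rule real_le_rsqrt)
    then show ?thesis by (simp add: real_sqrt_mult)
  qed
  then show ?thesis using le by (simp add: n_def l_def)
qed

lemma discrepancy_le_sqrt_height: "discrepancy f \<le> sqrt 2 * sqrt (height f)"
  unfolding discrepancy_def
proof (rule cSup_least)
  show "{real (root_count f \<alpha> \<beta>) / real (degree f) - (\<beta> - \<alpha>) |\<alpha> \<beta>. \<alpha> \<le> \<beta> \<and> \<beta> < \<alpha> + 1} \<noteq> {}"
    by (auto intro!: exI[of _ "0::real"])
qed (use root_count_excess_le in blast)

text \<open>The supremum is known to be finite from the upper bound itself.\<close>

lemma discrepancy_ge:
  assumes "\<alpha> \<le> \<beta>" "\<beta> < \<alpha> + 1"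
  shows "real (root_count f \<alpha> \<beta>) / real (degree f) - (\<beta> - \<alpha>) \<le> discrepancy f"
  unfolding discrepancy_def
proof (rule cSup_upper)
  show "bdd_above {real (root_count f \<alpha> \<beta>) / real (degree f) - (\<beta> - \<alpha>) |\<alpha> \<beta>. \<alpha> \<le> \<beta> \<and> \<beta> < \<alpha> + 1}"
    using root_count_excess_le by (intro bdd_aboveI[of _ "sqrt 2 * sqrt (height f)"]) blast
qed (use assms in blast)

end

section \<open>Gegenbauer polynomials\<close>

text \<open>The coefficients of \<open>(1 - x)^(-m)\<close>; the truncated subtraction only matters for \<open>m = 0\<close>.\<close>

definition multichoose :: "nat \<Rightarrow> nat \<Rightarrow> real" where
  "multichoose m k = real ((m + k - 1) choose k)"

lemma multichoose_Suc:
  assumes "m > 0" shows "real (Suc k) * multichoose m (Suc k) = (real k + real m) * multichoose m k"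
proof -
  have "Suc k * (Suc (m + k - 1) choose Suc k) = Suc (m + k - 1) * (m + k - 1 choose k)"
    by (rule Suc_times_binomial)
  then have "real (Suc k) * real (Suc (m + k - 1) choose Suc k) = real (Suc (m + k - 1)) * real (m + k - 1 choose k)"
    by (metis of_nat_mult)
  then show ?thesis using assms by (simp add: multichoose_def algebra_simps)
qed

lemma multichoose_pos: "m > 0 \<Longrightarrow> multichoose m k > 0"
  by (simp add: multichoose_def)

lemma multichoose_0 [simp]: "multichoose m 0 = 1"
  by (simp add: multichoose_def)

text \<open>Compare the coefficients of \<open>X^(2M)\<close> in
  \<open>(1 + X)^(-m) (1 - X)^(-m) = (1 - X\<^sup>2)^(-m)\<close>.\<close>

lemma multichoose_alternating_sum:
  assumes "m > 0"
  shows "(\<Sum>k\<le>2 * M. (-1) ^ k * (multichoose m k * multichoose m (2 * M - k))) = multichoose m M"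
proof -
  let ?X = "fps_X :: real fps"
  have A: "inverse ((1 - ?X) ^ m) = Abs_fps (multichoose m)"
    using one_minus_const_fps_X_neg_power'[OF assms, of "1::real"] by (simp add: multichoose_def[abs_def])
  have B: "inverse ((1 + ?X) ^ m) = Abs_fps (\<lambda>k. multichoose m k * (-1) ^ k)"
    using one_minus_const_fps_X_neg_power'[OF assms, of "-1::real"]
    by (simp add: multichoose_def[abs_def] flip: fps_const_neg)
  have "Abs_fps (multichoose m) oo ?X\<^sup>2 = inverse ((1 - ?X) ^ m oo ?X\<^sup>2)"
    unfolding A[symmetric] by (rule fps_inverse_compose) (auto simp: fps_power_zeroth_eq_one)
  also have "(1 - ?X) ^ m oo ?X\<^sup>2 = (1 - ?X\<^sup>2) ^ m"
    by (simp add: fps_compose_power[symmetric] fps_compose_sub_distrib)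
  also have "1 - ?X\<^sup>2 = (1 + ?X) * (1 - ?X)" by (simp add: algebra_simps power2_eq_square)
  also have "inverse (((1 + ?X) * (1 - ?X)) ^ m) = Abs_fps (\<lambda>k. multichoose m k * (-1) ^ k) * Abs_fps (multichoose m)"
    by (simp add: power_mult_distrib fps_inverse_mult A B)
  finally have "fps_nth (Abs_fps (multichoose m) oo ?X\<^sup>2) (2 * M) = fps_nth (Abs_fps (\<lambda>k. multichoose m k * (-1) ^ k) * Abs_fps (multichoose m)) (2 * M)"
    by simp
  moreover have "fps_nth (Abs_fps (multichoose m) oo ?X\<^sup>2) (2 * M) = (\<Sum>i = 0..2 * M. if i = M then multichoose m i else 0)"
    unfolding fps_compose_nth by (intro sum.cong) (auto simp flip: power_mult)
  then have "fps_nth (Abs_fps (multichoose m) oo ?X\<^sup>2) (2 * M) = multichoose m M" by simp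
  ultimately have "(\<Sum>i = 0..2 * M. (multichoose m i * (-1) ^ i) * multichoose m (2 * M - i)) = multichoose m M"
    by (simp only: fps_mult_nth fps_nth_Abs_fps)
  then show ?thesis by (simp add: atMost_atLeast0 mult_ac)
qed

text \<open>Passing from \<open>m\<close> to \<open>m + 1\<close> multiplies the left side by
  \<open>2 (M + m) / (2 M + m)\<close>, at most \<open>exp (m / (2 M))\<close>, and
  \<open>m\<^sup>2 + 2 m <= (m + 1)\<^sup>2\<close> absorbs this in the exponent. The factor 2 in
  front is the case \<open>m = 1\<close>.\<close>

lemma multichoose_ratio:
  assumes "M > 0"
  shows "2 ^ (Suc p) * multichoose (Suc p) M / multichoose (Suc p) (2 * M) \<le> 2 * exp (real (Suc p) ^ 2 / (4 * real M))"
proof (induction p)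
  case 0
  have "multichoose (Suc 0) k = 1" for k by (simp add: multichoose_def)
  then show ?case by simp
next
  case (Suc p)
  let ?N = "2 * M"
  have rec: "multichoose (Suc (Suc p)) k = multichoose (Suc p) k * (real k + real (Suc p)) / real (Suc p)" for k
  proof -
    have "Suc p * (Suc (p + k) choose Suc p) = Suc (p + k) * (p + k choose p)"
      by (rule Suc_times_binomial)
    then have "real (Suc p) * real (Suc (p + k) choose Suc p) = real (Suc (p + k)) * real (p + k choose p)"
      by (metis of_nat_mult)
    moreover have "Suc (p + k) choose Suc p = Suc (p + k) choose k"
      using binomial_symmetric[of "Suc p" "Suc (p + k)"] by (simp del: binomial_Suc_Suc)
    moreover have "p + k choose p = p + k choose k"
      using binomial_symmetric[of p "p + k"] by simp
    ultimately have "real (Suc p) * real (Suc (p + k) choose k) = real (Suc (p + k)) * real (p + k choose k)"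
      by (simp only:)
    then show ?thesis by (simp add: multichoose_def field_simps)
  qed
  have pos: "multichoose (Suc p) ?N > 0" by (simp add: multichoose_pos)
  have "2 ^ Suc (Suc p) * multichoose (Suc (Suc p)) M / multichoose (Suc (Suc p)) ?N =
      (2 ^ Suc p * multichoose (Suc p) M / multichoose (Suc p) ?N) * (2 * (real M + real (Suc p)) / (real ?N + real (Suc p)))"
  proof -
    have "(2 * x) * (g * a / P) / (h * b / P) = (x * g / h) * (2 * a / b)" if "P > 0" for x g h a b P :: real
      using that by simp
    then show ?thesis unfolding rec power_Suc[of 2 "Suc p"] by (simp only: of_nat_0_less_iff zero_less_Suc)
  qed
  also have "\<dots> \<le> (2 * exp (real (Suc p) ^ 2 / (4 * real M))) * exp (real (Suc p) / (2 * real M))"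
  proof (rule mult_mono[OF Suc])
    have "2 * (real M + real (Suc p)) / (real ?N + real (Suc p)) = 1 + real (Suc p) / (real ?N + real (Suc p))"
      using assms by (simp add: field_simps)
    also have "\<dots> \<le> 1 + real (Suc p) / (2 * real M)"
      using assms by (intro add_left_mono divide_left_mono) auto
    also have "\<dots> \<le> exp (real (Suc p) / (2 * real M))" by (rule exp_ge_add_one_self)
    finally show "2 * (real M + real (Suc p)) / (real ?N + real (Suc p)) \<le> exp (real (Suc p) / (2 * real M))" .
  qed auto
  also have "\<dots> = 2 * exp ((real (Suc p) ^ 2 + 2 * real (Suc p)) / (4 * real M))"
    by (simp add: exp_add[symmetric] add_divide_distrib)
  also have "\<dots> \<le> 2 * exp (real (Suc (Suc p)) ^ 2 / (4 * real M))"
    by (simp add: divide_right_mono power2_eq_square algebra_simps)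
  finally show ?case .
qed

context
  fixes p N :: nat
begin

text \<open>These are the coefficients of \<open>C_N^m (cos t)\<close> as a cosine sum, with
  \<open>m = p + 2\<close>, coming from the generating function
  \<open>(1 - x e^(it))^(-m) (1 - x e^(-it))^(-m)\<close>. Writing \<open>p + 2\<close> keeps the
  exponent \<open>m - 2\<close> free of truncated subtraction.\<close>

definition gegenbauer_coeff :: "nat \<Rightarrow> real" where "gegenbauer_coeff k = multichoose (p + 2) k * multichoose (p + 2) (N - k)"
definition gegenbauer_freq :: "nat \<Rightarrow> real" where "gegenbauer_freq k = real N - 2 * real k"
definition gegenbauer :: "real \<Rightarrow> real" where "gegenbauer t = (\<Sum>k\<le>N. gegenbauer_coeff k * cos (gegenbauer_freq k * t))"
definition gegenbauer' :: "real \<Rightarrow> real" where "gegenbauer' t = (\<Sum>k\<le>N. gegenbauer_coeff k * (- gegenbauer_freq k * sin (gegenbauer_freq k * t)))"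
definition gegenbauer'' :: "real \<Rightarrow> real" where "gegenbauer'' t = (\<Sum>k\<le>N. gegenbauer_coeff k * (- (gegenbauer_freq k)\<^sup>2 * cos (gegenbauer_freq k * t)))"

lemma DERIV_gegenbauer: "(gegenbauer has_real_derivative gegenbauer' t) (at t)"
  unfolding gegenbauer_def gegenbauer'_def by (auto intro!: derivative_eq_intros sum.cong simp: algebra_simps)

lemma DERIV_gegenbauer': "(gegenbauer' has_real_derivative gegenbauer'' t) (at t)"
  unfolding gegenbauer'_def gegenbauer''_def by (auto intro!: derivative_eq_intros sum.cong simp: algebra_simps power2_eq_square)

text \<open>Each frequency contributes sines of its two neighbours
  \<open>gegenbauer_freq k + 1\<close> and \<open>gegenbauer_freq k - 1\<close>; by
  \<open>multichoose_Suc\<close> the contributions telescope.\<close>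

lemma gegenbauer_ode:
  "sin t * gegenbauer'' t + 2 * real (p + 2) * cos t * gegenbauer' t + real N * (real N + 2 * real (p + 2)) * sin t * gegenbauer t = 0"
proof -
  define m where "m = real (p + 2)"
  define T where "T k = (if k \<le> N then 2 * gegenbauer_coeff k * real k * (real N - real k + m) * sin ((gegenbauer_freq k + 1) * t) else 0)" for k
  have step: "gegenbauer_coeff k * (sin t * (- (gegenbauer_freq k)\<^sup>2 * cos (gegenbauer_freq k * t)) + 2 * m * cos t * (- gegenbauer_freq k * sin (gegenbauer_freq k * t))
      + real N * (real N + 2 * m) * sin t * cos (gegenbauer_freq k * t)) = T k - T (Suc k)" if k: "k \<le> N" for k
  proof -
    define s c where "s = sin (gegenbauer_freq k * t)" and "c = cos (gegenbauer_freq k * t)"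
    have s1: "sin ((gegenbauer_freq k + 1) * t) = s * cos t + c * sin t" by (simp add: s_def c_def distrib_right sin_add)
    have s2: "sin ((gegenbauer_freq (Suc k) + 1) * t) = s * cos t - c * sin t"
    proof -
      have "(gegenbauer_freq (Suc k) + 1) * t = gegenbauer_freq k * t - t" by (simp add: gegenbauer_freq_def algebra_simps)
      then show ?thesis by (simp add: s_def c_def sin_diff)
    qed
    have TS: "T (Suc k) = 2 * gegenbauer_coeff k * (real N - real k) * (real k + m) * sin ((gegenbauer_freq (Suc k) + 1) * t)"
    proof (cases "k = N")
      case True
      then show ?thesis by (simp add: T_def)
    next
      case False
      define q where "q = N - Suc k"
      have q: "N - k = Suc q" using False k by (simp add: q_def Suc_diff_Suc)
      then have q': "N - Suc k = q" "real N - real k = real (Suc q)" "real N - real (Suc k) = real q" using k by auto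
      have a: "real (Suc k) * multichoose (p+2) (Suc k) = (real k + m) * multichoose (p+2) k"
        using multichoose_Suc[of "p+2" k] by (simp add: m_def)
      have b: "real (Suc q) * multichoose (p+2) (Suc q) = (real q + m) * multichoose (p+2) q"
        using multichoose_Suc[of "p+2" q] by (simp add: m_def)
      have "gegenbauer_coeff (Suc k) * real (Suc k) * (real N - real (Suc k) + m)
          = (real (Suc k) * multichoose (p+2) (Suc k)) * ((real q + m) * multichoose (p+2) q)"
        by (simp only: gegenbauer_coeff_def q' mult_ac)
      also have "\<dots> = gegenbauer_coeff k * (real N - real k) * (real k + m)"
        unfolding a b[symmetric] by (simp only: gegenbauer_coeff_def q q' mult_ac)
      finally show ?thesis using False k by (simp add: T_def mult.assoc)
    qed
    define J where "J = gegenbauer_freq k"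
    have J: "real N = J + 2 * real k" by (simp add: J_def gegenbauer_freq_def)
    have Tk: "T k = 2 * gegenbauer_coeff k * real k * (real N - real k + m) * (s * cos t + c * sin t)"
      using k s1 by (simp add: T_def)
    show ?thesis
      unfolding Tk TS s2 s_def[symmetric] c_def[symmetric] unfolding J_def[symmetric] J
      by (simp add: algebra_simps power2_eq_square)
  qed
  have "sin t * gegenbauer'' t + 2 * m * cos t * gegenbauer' t + real N * (real N + 2 * m) * sin t * gegenbauer t
     = (\<Sum>k\<le>N. gegenbauer_coeff k * (sin t * (- (gegenbauer_freq k)\<^sup>2 * cos (gegenbauer_freq k * t)) + 2 * m * cos t * (- gegenbauer_freq k * sin (gegenbauer_freq k * t))
      + real N * (real N + 2 * m) * sin t * cos (gegenbauer_freq k * t)))"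
    by (simp add: gegenbauer_def gegenbauer'_def gegenbauer''_def sum_distrib_left sum.distrib[symmetric] algebra_simps)
  also have "\<dots> = (\<Sum>k\<le>N. T k - T (Suc k))" by (intro sum.cong refl step) auto
  also have "\<dots> = T 0 - T (Suc N)" by (rule sum_telescope)
  also have "\<dots> = 0" by (simp add: T_def)
  finally show ?thesis by (simp add: m_def)
qed

section \<open>Normal form of the differential equation and the energy estimate\<close>

definition weighted_gegenbauer :: "real \<Rightarrow> real" where "weighted_gegenbauer t = sin t ^ (p + 2) * gegenbauer t"
definition weighted_gegenbauer' :: "real \<Rightarrow> real" where
  "weighted_gegenbauer' t = real (p + 2) * sin t ^ (p + 1) * cos t * gegenbauer t + sin t ^ (p + 2) * gegenbauer' t"
definition weighted_gegenbauer_potential :: "real \<Rightarrow> real" where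
  "weighted_gegenbauer_potential t = (real N + real (p + 2))\<^sup>2 - real (p + 2) * real (p + 1) / (sin t)\<^sup>2"

lemma DERIV_sin_power:
  "((\<lambda>t::real. sin t ^ Suc k) has_real_derivative real (Suc k) * sin t ^ k * cos t) (at t)"
  using DERIV_power[OF DERIV_sin[of t], of "Suc k"] by (simp add: mult_ac)

lemma DERIV_weighted_gegenbauer: "(weighted_gegenbauer has_real_derivative weighted_gegenbauer' t) (at t)"
  using DERIV_mult[OF DERIV_sin_power[of "p+1" t] DERIV_gegenbauer[of t]]
  by (simp add: weighted_gegenbauer_def[abs_def] weighted_gegenbauer'_def algebra_simps)

text \<open>The weight \<open>sin^m\<close> removes the first-order term of
  \<open>gegenbauer_ode\<close>.\<close>

lemma DERIV_weighted_gegenbauer':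
  assumes "sin t \<noteq> 0"
  shows "(weighted_gegenbauer' has_real_derivative - (weighted_gegenbauer_potential t * weighted_gegenbauer t)) (at t)"
proof -
  define m where "m = real (p + 2)"
  define m1 where "m1 = real (p + 1)"
  define s c where "s = sin t" and "c = cos t"
  have sc: "c\<^sup>2 = 1 - s\<^sup>2" by (simp add: s_def c_def cos_squared_eq)
  have mm: "m = m1 + 1" by (simp add: m_def m1_def)
  have "(weighted_gegenbauer' has_real_derivative
      m * ((m1 * s ^ p * c * c + s ^ (p+1) * (- s)) * gegenbauer t + s ^ (p+1) * c * gegenbauer' t)
       + (m * s ^ (p+1) * c * gegenbauer' t + s ^ (p+2) * gegenbauer'' t)) (at t)"
  proof -
    have d1: "((\<lambda>t. m * (sin t ^ (p+1) * cos t * gegenbauer t)) has_real_derivative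
        m * ((m1 * s ^ p * c * c + s ^ (p+1) * (- s)) * gegenbauer t + s ^ (p+1) * c * gegenbauer' t)) (at t)"
      using DERIV_cmult[OF DERIV_mult[OF DERIV_mult[OF DERIV_sin_power[of p t] DERIV_cos] DERIV_gegenbauer[of t]], of m]
      by (simp add: s_def c_def m1_def mult_ac add_ac)
    have d2: "((\<lambda>t. sin t ^ (p+2) * gegenbauer' t) has_real_derivative
        m * s ^ (p+1) * c * gegenbauer' t + s ^ (p+2) * gegenbauer'' t) (at t)"
      using DERIV_mult[OF DERIV_sin_power[of "p+1" t] DERIV_gegenbauer'[of t]]
      by (simp add: s_def c_def m_def algebra_simps)
    show ?thesis using DERIV_add[OF d1 d2] by (simp add: weighted_gegenbauer'_def[abs_def] m_def mult_ac)
  qed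
  also have "m * ((m1 * s ^ p * c * c + s ^ (p+1) * (- s)) * gegenbauer t + s ^ (p+1) * c * gegenbauer' t)
       + (m * s ^ (p+1) * c * gegenbauer' t + s ^ (p+2) * gegenbauer'' t)
     = m * m1 * s ^ p * c\<^sup>2 * gegenbauer t - m * s ^ (p+2) * gegenbauer t + s ^ (p+1) * (s * gegenbauer'' t + 2 * m * c * gegenbauer' t)"
    by (simp add: algebra_simps power2_eq_square)
  also have "s * gegenbauer'' t + 2 * m * c * gegenbauer' t = - (real N * (real N + 2 * m) * s * gegenbauer t)"
    using gegenbauer_ode[of t] by (simp add: s_def c_def m_def)
  also have "m * m1 * s ^ p * c\<^sup>2 * gegenbauer t - m * s ^ (p+2) * gegenbauer t + s ^ (p+1) * (- (real N * (real N + 2 * m) * s * gegenbauer t))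
     = - (((real N + m)\<^sup>2 - m * m1 / s\<^sup>2) * (s ^ (p+2) * gegenbauer t))"
    unfolding sc using assms by (simp add: s_def[symmetric] field_simps power2_eq_square mm)
  finally show ?thesis by (simp add: weighted_gegenbauer_potential_def weighted_gegenbauer_def m_def m1_def s_def)
qed

lemma abs_weighted_gegenbauer_minus: "\<bar>weighted_gegenbauer (- t)\<bar> = \<bar>weighted_gegenbauer t\<bar>"
  by (simp add: weighted_gegenbauer_def gegenbauer_def abs_mult power_abs)

lemma weighted_gegenbauer'_half_pi: "even N \<Longrightarrow> weighted_gegenbauer' (pi/2) = 0"
proof -
  assume "even N"
  then obtain M where M: "N = 2 * M" by auto
  have "sin (gegenbauer_freq k * (pi/2)) = 0" for k
  proof -
    have "real N = 2 * real M" using M by simp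
    then have "gegenbauer_freq k = 2 * of_int (int M - int k)" by (simp add: gegenbauer_freq_def)
    then have "gegenbauer_freq k * (pi/2) = of_int (int M - int k) * pi" by simp
    then show ?thesis by (metis sin_npi_int mult.commute)
  qed
  then show ?thesis by (simp add: weighted_gegenbauer'_def gegenbauer'_def)
qed

text \<open>For \<open>y'' = - Q y\<close> the derivative of \<open>Q y\<^sup>2 + y'\<^sup>2\<close>
  is \<open>Q' y\<^sup>2\<close>, and \<open>Q\<close> increases up to \<open>pi/2\<close>.\<close>

lemma weighted_gegenbauer_energy_mono:
  assumes "0 < a" "a \<le> pi/2"
  shows "weighted_gegenbauer_potential a * (weighted_gegenbauer a)\<^sup>2 + (weighted_gegenbauer' a)\<^sup>2 \<le> weighted_gegenbauer_potential (pi/2) * (weighted_gegenbauer (pi/2))\<^sup>2 + (weighted_gegenbauer' (pi/2))\<^sup>2"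
proof (rule DERIV_nonneg_imp_nondecreasing[OF assms(2), of "\<lambda>t. weighted_gegenbauer_potential t * (weighted_gegenbauer t)\<^sup>2 + (weighted_gegenbauer' t)\<^sup>2"])
  fix t assume t: "a \<le> t" "t \<le> pi/2"
  have s: "sin t > 0" and c: "cos t \<ge> 0" using t assms by (auto intro!: sin_gt_zero cos_ge_zero)
  have dQ: "(weighted_gegenbauer_potential has_real_derivative 2 * (real (p+2) * real (p+1)) * cos t / sin t ^ 3) (at t)"
    unfolding weighted_gegenbauer_potential_def using s
    by (auto intro!: derivative_eq_intros simp: field_simps power2_eq_square power3_eq_cube)
  have "((\<lambda>t. weighted_gegenbauer_potential t * (weighted_gegenbauer t)\<^sup>2 + (weighted_gegenbauer' t)\<^sup>2) has_real_derivative
     2 * (real (p+2) * real (p+1)) * cos t / sin t ^ 3 * (weighted_gegenbauer t)\<^sup>2) (at t)"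
    using s by (auto intro!: derivative_eq_intros dQ DERIV_weighted_gegenbauer DERIV_weighted_gegenbauer' simp: power2_eq_square)
  moreover have "2 * (real (p+2) * real (p+1)) * cos t / sin t ^ 3 * (weighted_gegenbauer t)\<^sup>2 \<ge> 0" using s c by simp
  ultimately show "\<exists>y. ((\<lambda>t. weighted_gegenbauer_potential t * (weighted_gegenbauer t)\<^sup>2 + (weighted_gegenbauer' t)\<^sup>2) has_real_derivative y) (at t) \<and> 0 \<le> y" by blast
qed

lemma weighted_gegenbauer_potential_mono: "0 < a \<Longrightarrow> a \<le> b \<Longrightarrow> b \<le> pi/2 \<Longrightarrow> weighted_gegenbauer_potential a \<le> weighted_gegenbauer_potential b"
proof -
  assume ab: "0 < a" "a \<le> b" "b \<le> pi/2"
  have "sin a > 0" using ab by (intro sin_gt_zero) auto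
  moreover have "sin a \<le> sin b" using ab by (intro sin_monotone_2pi_le) auto
  ultimately have "(sin a)\<^sup>2 \<le> (sin b)\<^sup>2" "(sin a)\<^sup>2 > 0" by (auto intro: power_mono)
  moreover from this have "(sin b)\<^sup>2 > 0" by linarith
  ultimately show "weighted_gegenbauer_potential a \<le> weighted_gegenbauer_potential b" unfolding weighted_gegenbauer_potential_def by (intro diff_left_mono divide_left_mono mult_pos_pos) auto
qed

text \<open>Where \<open>Q >= 0\<close> the energy bounds \<open>|y'|\<close> by
  \<open>(N + m) |y (pi/2)|\<close>, as \<open>y' (pi/2) = 0\<close>; the mean value theorem over a
  length of at most 2 gives the bound.\<close>

lemma weighted_gegenbauer_bound_oscillatory:
  assumes "even N" "0 < a" "a \<le> pi/2" "weighted_gegenbauer_potential a \<ge> 0"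
  shows "\<bar>weighted_gegenbauer a\<bar> \<le> (1 + 2 * (real N + real (p+2))) * \<bar>weighted_gegenbauer (pi/2)\<bar>"
proof (cases "a = pi/2")
  case True
  show ?thesis unfolding True by (simp add: distrib_right)
next
  case False
  let ?n = "real N + real (p+2)"
  obtain \<xi> where \<xi>: "a < \<xi>" "\<xi> < pi/2" "weighted_gegenbauer (pi/2) - weighted_gegenbauer a = (pi/2 - a) * weighted_gegenbauer' \<xi>"
    using MVT2[of a "pi/2" weighted_gegenbauer weighted_gegenbauer'] DERIV_weighted_gegenbauer assms False by auto
  have "weighted_gegenbauer_potential \<xi> \<ge> 0" using weighted_gegenbauer_potential_mono[of a \<xi>] assms \<xi> by simp
  then have "(weighted_gegenbauer' \<xi>)\<^sup>2 \<le> weighted_gegenbauer_potential \<xi> * (weighted_gegenbauer \<xi>)\<^sup>2 + (weighted_gegenbauer' \<xi>)\<^sup>2" by simp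
  also have "\<dots> \<le> weighted_gegenbauer_potential (pi/2) * (weighted_gegenbauer (pi/2))\<^sup>2"
    using weighted_gegenbauer_energy_mono[of \<xi>] \<xi> assms by (simp add: weighted_gegenbauer'_half_pi)
  also have "\<dots> \<le> ?n\<^sup>2 * (weighted_gegenbauer (pi/2))\<^sup>2" by (intro mult_right_mono) (auto simp: weighted_gegenbauer_potential_def)
  also have "\<dots> = (?n * \<bar>weighted_gegenbauer (pi/2)\<bar>)\<^sup>2" by (simp add: power_mult_distrib)
  finally have "\<bar>weighted_gegenbauer' \<xi>\<bar> \<le> ?n * \<bar>weighted_gegenbauer (pi/2)\<bar>" by (simp add: abs_le_square_iff[symmetric])
  then have "(pi/2 - a) * \<bar>weighted_gegenbauer' \<xi>\<bar> \<le> 2 * (?n * \<bar>weighted_gegenbauer (pi/2)\<bar>)"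
    using \<xi> assms pi_less_4 by (intro mult_mono) auto
  moreover have "\<bar>weighted_gegenbauer a\<bar> \<le> \<bar>weighted_gegenbauer (pi/2)\<bar> + (pi/2 - a) * \<bar>weighted_gegenbauer' \<xi>\<bar>"
  proof -
    have "weighted_gegenbauer a = weighted_gegenbauer (pi/2) - (pi/2 - a) * weighted_gegenbauer' \<xi>" using \<xi>(3) by simp
    then have "\<bar>weighted_gegenbauer a\<bar> \<le> \<bar>weighted_gegenbauer (pi/2)\<bar> + \<bar>(pi/2 - a) * weighted_gegenbauer' \<xi>\<bar>" by linarith
    then show ?thesis using \<xi> by (simp add: abs_mult)
  qed
  ultimately show ?thesis by (simp add: algebra_simps)
qed

lemma weighted_gegenbauer_bound_nonneg:
  assumes "even N" "0 \<le> a" "a \<le> pi/2"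
  shows "\<bar>weighted_gegenbauer a\<bar> \<le> (1 + 2 * (real N + real (p+2))) * \<bar>weighted_gegenbauer (pi/2)\<bar>"
proof -
  let ?n = "real N + real (p+2)"
  define q where "q = sqrt (real (p+2) * real (p+1)) / ?n"
  have "real (p+2) * real (p+1) < ?n\<^sup>2"
  proof -
    have "real (p+2) * real (p+1) < real (p+2) * real (p+2)" by simp
    also have "\<dots> \<le> ?n * ?n" by (intro mult_mono) auto
    finally show ?thesis by (simp add: power2_eq_square)
  qed
  then have "sqrt (real (p+2) * real (p+1)) < ?n" by (intro real_less_lsqrt) auto
  then have q: "0 < q" "q < 1" by (auto simp: q_def)
  \<comment> \<open>the turning point: below it \<open>y\<^sup>2\<close> increases, above it the energy controls \<open>y'\<close>\<close>
  define t0 where "t0 = arcsin q"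
  have t0: "0 < t0" "t0 < pi/2" "sin t0 = q"
    using q arcsin_less_arcsin[of 0 q] arcsin_lt_bounded[of q] by (auto simp: t0_def)
  have Q0: "weighted_gegenbauer_potential t0 = 0" by (simp add: weighted_gegenbauer_potential_def t0 q_def power_divide)
  show ?thesis
  proof (cases "a \<ge> t0")
    case True
    then have "weighted_gegenbauer_potential a \<ge> 0" using weighted_gegenbauer_potential_mono[of t0 a] t0 assms Q0 by simp
    then show ?thesis using True t0 assms by (intro weighted_gegenbauer_bound_oscillatory) auto
  next
    case False
    define W where "W t = weighted_gegenbauer t * weighted_gegenbauer' t" for t
    have dW: "(W has_real_derivative (weighted_gegenbauer' t)\<^sup>2 - weighted_gegenbauer_potential t * (weighted_gegenbauer t)\<^sup>2) (at t)" if "sin t \<noteq> 0" for t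
      unfolding W_def using that
      by (auto intro!: derivative_eq_intros DERIV_weighted_gegenbauer DERIV_weighted_gegenbauer' simp: power2_eq_square)
    have contW: "continuous_on S W" for S
    proof -
      have "continuous_on S weighted_gegenbauer" by (rule DERIV_continuous_on[of _ _ weighted_gegenbauer']) (auto intro: DERIV_weighted_gegenbauer has_field_derivative_at_within)
      moreover have "continuous_on S gegenbauer'" by (rule DERIV_continuous_on[of _ _ gegenbauer'']) (auto intro: DERIV_gegenbauer' has_field_derivative_at_within)
      moreover have "continuous_on S gegenbauer" by (rule DERIV_continuous_on[of _ _ gegenbauer']) (auto intro: DERIV_gegenbauer has_field_derivative_at_within)
      ultimately show ?thesis unfolding W_def weighted_gegenbauer'_def by (intro continuous_intros)
    qed
    have W: "W t \<ge> 0" if "0 \<le> t" "t \<le> t0" for t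
    proof -
      have "W 0 \<le> W t"
      proof (rule DERIV_nonneg_imp_increasing_open[OF that(1) _ contW])
        fix x assume x: "0 < x" "x < t"
        then have "sin x > 0" using that t0 by (intro sin_gt_zero) auto
        moreover have "weighted_gegenbauer_potential x \<le> 0" using weighted_gegenbauer_potential_mono[of x t0] x that t0 Q0 by simp
        then have "weighted_gegenbauer_potential x * (weighted_gegenbauer x)\<^sup>2 \<le> 0" by (simp add: mult_nonpos_nonneg)
        ultimately show "\<exists>y. (W has_real_derivative y) (at x) \<and> y \<ge> 0"
          using dW[of x] by (intro exI[of _ "(weighted_gegenbauer' x)\<^sup>2 - weighted_gegenbauer_potential x * (weighted_gegenbauer x)\<^sup>2"]) (auto intro: order_trans[of _ 0])
      qed
      then show ?thesis by (simp add: W_def weighted_gegenbauer_def)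
    qed
    have "(weighted_gegenbauer a)\<^sup>2 \<le> (weighted_gegenbauer t0)\<^sup>2"
    proof (rule DERIV_nonneg_imp_nondecreasing[of a t0 "\<lambda>t. (weighted_gegenbauer t)\<^sup>2"])
      fix t assume "a \<le> t" "t \<le> t0"
      then show "\<exists>y. ((\<lambda>t. (weighted_gegenbauer t)\<^sup>2) has_real_derivative y) (at t) \<and> 0 \<le> y"
        using W[of t] assms
        by (intro exI[of _ "2 * W t"]) (auto intro!: derivative_eq_intros DERIV_weighted_gegenbauer simp: W_def)
    qed (use False in auto)
    then have "\<bar>weighted_gegenbauer a\<bar> \<le> \<bar>weighted_gegenbauer t0\<bar>" by (simp add: abs_le_square_iff)
    also have "\<dots> \<le> (1 + 2 * ?n) * \<bar>weighted_gegenbauer (pi/2)\<bar>" using t0 assms Q0 by (intro weighted_gegenbauer_bound_oscillatory) auto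
    finally show ?thesis .
  qed
qed

lemma weighted_gegenbauer_bound:
  assumes "even N" "\<bar>a\<bar> \<le> pi/2"
  shows "\<bar>weighted_gegenbauer a\<bar> \<le> (1 + 2 * (real N + real (p+2))) * \<bar>weighted_gegenbauer (pi/2)\<bar>"
  using weighted_gegenbauer_bound_nonneg[of a] weighted_gegenbauer_bound_nonneg[of "-a"] abs_weighted_gegenbauer_minus[of a] assms by (cases "a \<ge> 0") auto

text \<open>At \<open>pi/2\<close> the cosines alternate in sign with \<open>k\<close>, which
  reduces the sum to \<open>multichoose_alternating_sum\<close>.\<close>

lemma abs_weighted_gegenbauer_half_pi:
  assumes "N = 2 * M" shows "\<bar>weighted_gegenbauer (pi/2)\<bar> = multichoose (p+2) M"
proof -
  have "cos (gegenbauer_freq k * (pi/2)) = (-1) ^ M * (-1) ^ k" for k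
  proof -
    have "real N = 2 * real M" using assms by simp
    then have g: "gegenbauer_freq k = 2 * (real M - real k)" by (simp add: gegenbauer_freq_def)
    have e: "gegenbauer_freq k * (pi/2) = pi * real M - pi * real k" unfolding g by (simp add: algebra_simps)
    show ?thesis unfolding e by (simp add: cos_diff cos_npi2 sin_npi2)
  qed
  then have "gegenbauer (pi/2) = (-1) ^ M * (\<Sum>k\<le>2 * M. (-1) ^ k * (multichoose (p+2) k * multichoose (p+2) (2 * M - k)))"
    unfolding gegenbauer_def gegenbauer_coeff_def sum_distrib_left assms[symmetric]
    by (intro sum.cong) (simp_all add: mult_ac)
  also have "\<dots> = (-1) ^ M * multichoose (p+2) M" by (subst multichoose_alternating_sum) auto
  finally show ?thesis using multichoose_pos[of "p+2" M] by (simp add: weighted_gegenbauer_def abs_mult power_abs)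
qed

end

section \<open>Sharpness\<close>

definition extremal_poly :: "nat \<Rightarrow> nat \<Rightarrow> complex poly" where
  "extremal_poly p M = [:-1, 1:] ^ (p + 2) * (\<Sum>k\<le>2 * M. monom (of_real (gegenbauer_coeff p (2 * M) k)) k)"

lemma cis_double_minus_1: "cis (2 * t) - 1 = cis t * (2 * \<i> * of_real (sin t))"
proof -
  have "2 * \<i> * of_real (sin t) = cis t - cis (- t)" by (simp add: complex_eq_iff)
  then have "cis t * (2 * \<i> * of_real (sin t)) = cis t * cis t - cis t * cis (- t)"
    by (simp only: right_diff_distrib)
  also have "\<dots> = cis (2 * t) - 1" by (simp add: cis_mult)
  finally show ?thesis by simp
qed

text \<open>At \<open>cis (2 * t)\<close> the second factor is \<open>cis (N t)\<close> times a sum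
  over the frequencies, which is real because the coefficients are symmetric under
  \<open>k -> N - k\<close>.\<close>

lemma norm_extremal_poly_cis: "norm (poly (extremal_poly p M) (cis (2 * t))) = 2 ^ (p + 2) * \<bar>weighted_gegenbauer p (2 * M) t\<bar>"
proof -
  define N where "N = 2 * M"
  let ?b = "gegenbauer_coeff p N" and ?j = "gegenbauer_freq N"
  have im: "(\<Sum>k\<le>N. ?b k * sin (?j k * t)) = 0"
  proof -
    have "(\<Sum>k\<le>N. ?b k * sin (?j k * t)) = (\<Sum>k\<le>N. ?b (N - k) * sin (?j (N - k) * t))"
      by (rule sum.reindex_bij_witness[of _ "\<lambda>k. N - k" "\<lambda>k. N - k"]) auto
    also have "\<dots> = (\<Sum>k\<le>N. - (?b k * sin (?j k * t)))"
    proof (intro sum.cong refl)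
      fix k assume "k \<in> {..N}"
      then have "?j (N - k) * t = - (?j k * t)" "?b (N - k) = ?b k"
        by (auto simp: gegenbauer_freq_def gegenbauer_coeff_def algebra_simps)
      then show "?b (N - k) * sin (?j (N - k) * t) = - (?b k * sin (?j k * t))" by simp
    qed
    finally show ?thesis by (simp add: sum_negf)
  qed
  have "(\<Sum>k\<le>N. of_real (?b k) * cis (2 * t) ^ k) = cis (real N * t) * (\<Sum>k\<le>N. of_real (?b k) * cis (- (?j k * t)))"
  proof -
    have "cis (2 * t) ^ k = cis (real N * t) * cis (- (?j k * t))" for k
      unfolding Complex.DeMoivre cis_mult by (simp add: gegenbauer_freq_def algebra_simps)
    then show ?thesis by (simp add: sum_distrib_left mult_ac)
  qed
  also have "(\<Sum>k\<le>N. of_real (?b k) * cis (- (?j k * t))) = of_real (gegenbauer p N t)"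
    using im by (simp add: complex_eq_iff gegenbauer_def sum_negf)
  finally have "norm (\<Sum>k\<le>N. of_real (?b k) * cis (2 * t) ^ k) = \<bar>gegenbauer p N t\<bar>"
    by (simp add: norm_mult)
  moreover have "poly (extremal_poly p M) (cis (2 * t)) = (cis (2 * t) - 1) ^ (p + 2) * (\<Sum>k\<le>N. of_real (?b k) * cis (2 * t) ^ k)"
    by (simp only: extremal_poly_def poly_mult poly_power poly_sum poly_monom N_def) simp
  moreover have "norm ((cis (2 * t) - 1) ^ (p + 2)) = 2 ^ (p + 2) * \<bar>sin t\<bar> ^ (p + 2)"
    unfolding norm_power cis_double_minus_1 by (simp add: norm_mult power_mult_distrib)
  ultimately show ?thesis
    by (simp add: norm_mult weighted_gegenbauer_def abs_mult power_abs N_def)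
qed

lemma norm_extremal_poly_le:
  assumes "norm z = 1"
  shows "norm (poly (extremal_poly p M) z) \<le> 2 ^ (p + 2) * ((1 + 2 * real (2 * M + p + 2)) * multichoose (p + 2) M)"
proof -
  define t where "t = Arg z / 2"
  have "cis (2 * t) = z" using assms cis_Arg[of z] by (cases "z = 0") (auto simp: t_def sgn_div_norm)
  moreover have "\<bar>t\<bar> \<le> pi/2" using mpi_less_Arg[of z] Arg_le_pi[of z] by (auto simp: t_def)
  then have "\<bar>weighted_gegenbauer p (2 * M) t\<bar> \<le> (1 + 2 * real (2 * M + p + 2)) * multichoose (p + 2) M"
    using weighted_gegenbauer_bound[of "2 * M" t p] abs_weighted_gegenbauer_half_pi[of "2 * M" M p] by (simp add: add.assoc)
  ultimately show ?thesis using norm_extremal_poly_cis[of p M t] by simp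
qed

lemma extremal_poly_coeffs:
  shows "degree (extremal_poly p M) = 2 * M + p + 2"
    and "lead_coeff (extremal_poly p M) = of_real (multichoose (p + 2) (2 * M))"
    and "norm (poly (extremal_poly p M) 0) = multichoose (p + 2) (2 * M)"
proof -
  define N where "N = 2 * M"
  define q :: "complex poly" where "q = (\<Sum>k\<le>N. monom (of_real (gegenbauer_coeff p N k)) k)"
  have cq: "coeff q i = (if i \<le> N then of_real (gegenbauer_coeff p N i) else 0)" for i
    by (simp add: q_def coeff_sum)
  have cN: "coeff q N = of_real (multichoose (p + 2) N)" "coeff q 0 = of_real (multichoose (p + 2) N)"
    by (simp_all add: cq gegenbauer_coeff_def)
  have g: "multichoose (p + 2) N > 0" by (simp add: multichoose_pos)
  have dq: "degree q = N"
  proof (rule antisym)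
    show "degree q \<le> N" by (rule degree_le) (simp add: cq)
    show "N \<le> degree q" by (rule le_degree) (use cN g in simp)
  qed
  have e: "extremal_poly p M = [:-1, 1:] ^ (p + 2) * q" by (simp only: extremal_poly_def q_def N_def)
  have q0: "q \<noteq> 0" using cN g by auto
  show "degree (extremal_poly p M) = 2 * M + p + 2"
    unfolding e using q0 by (subst degree_mult_eq) (auto simp: degree_power_eq dq N_def simp del: power_Suc)
  show "lead_coeff (extremal_poly p M) = of_real (multichoose (p + 2) (2 * M))"
    unfolding e lead_coeff_mult lead_coeff_power dq cN by (simp add: N_def)
  show "norm (poly (extremal_poly p M) 0) = multichoose (p + 2) (2 * M)"
    unfolding e poly_mult poly_power norm_mult norm_power poly_0_coeff_0[of q] cN(2)
    using g by (simp add: N_def)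
qed

lemma height_extremal_poly_le:
  fixes p M :: nat
  assumes "M > 0"
  defines "n \<equiv> real (2 * M + p + 2)"
  shows "height (extremal_poly p M) \<le> (ln (2 + 4 * n) + (real (p + 2))\<^sup>2 / (4 * real M)) / n"
proof -
  let ?f = "extremal_poly p M" and ?g = "multichoose (p + 2)"
  note co = extremal_poly_coeffs[of p M]
  have g: "?g (2 * M) > 0" by (simp add: multichoose_pos)
  have n: "n > 0" by (simp add: n_def)
  have f: "degree ?f \<ge> 1" "poly ?f 0 \<noteq> 0" using co g by auto
  have s: "sqrt (norm (coeff ?f 0 * lead_coeff ?f)) = ?g (2 * M)"
    using co g by (simp add: norm_mult poly_0_coeff_0)
  have "Sup ((\<lambda>z. norm (poly ?f z)) ` sphere 0 1) \<le> 2 ^ (p + 2) * ((1 + 2 * n) * ?g M)"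
    unfolding n_def by (rule cSUP_least) (use norm_extremal_poly_le in auto)
  then have "height_max ?f \<le> 2 ^ (p + 2) * ((1 + 2 * n) * ?g M) / ?g (2 * M)"
    unfolding height_max_def s using g by (intro divide_right_mono) auto
  also have "\<dots> = (1 + 2 * n) * (2 ^ Suc (p + 1) * multichoose (Suc (p + 1)) M / multichoose (Suc (p + 1)) (2 * M))"
    by simp
  also have "\<dots> \<le> (1 + 2 * n) * (2 * exp (real (Suc (p + 1)) ^ 2 / (4 * real M)))"
    using n by (intro mult_left_mono multichoose_ratio assms) auto
  finally have h: "height_max ?f \<le> (2 + 4 * n) * exp ((real (p + 2))\<^sup>2 / (4 * real M))" by (simp add: algebra_simps)
  have "height_max ?f > 0" using height_max_ge_1[OF f] by simp
  then have "ln (height_max ?f) \<le> ln ((2 + 4 * n) * exp ((real (p + 2))\<^sup>2 / (4 * real M)))"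
    using h by (subst ln_le_cancel_iff) (auto intro: order_less_le_trans)
  also have "\<dots> = ln (2 + 4 * n) + (real (p + 2))\<^sup>2 / (4 * real M)"
    using n by (simp add: ln_mult)
  finally show ?thesis unfolding height_eq co n_def using n by (intro divide_right_mono) auto
qed

text \<open>The degenerate arc \<open>[0, 0]\<close> already contains the root 1, whose multiplicity
  is at least \<open>p + 2\<close>.\<close>

lemma discrepancy_extremal_poly_ge:
  "real (p + 2) / real (2 * M + p + 2) \<le> discrepancy (extremal_poly p M)"
proof -
  let ?f = "extremal_poly p M"
  note co = extremal_poly_coeffs[of p M]
  have g: "multichoose (p + 2) (2 * M) > 0" by (simp add: multichoose_pos)
  have f: "degree ?f \<ge> 1" "poly ?f 0 \<noteq> 0" using co g by auto
  then have f0: "?f \<noteq> 0" by auto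
  have "[:-1, 1:] ^ (p + 2) dvd ?f" by (simp only: extremal_poly_def dvd_triv_left)
  then have o: "p + 2 \<le> order 1 ?f" using f0 order_divides[of 1 "p + 2" ?f] by blast
  then have "poly ?f 1 = 0" using f0 by (simp add: order_root)
  then have "order 1 ?f \<le> root_count ?f 0 0"
    unfolding root_count_def using f0
    by (intro member_le_sum) (auto simp: on_arc_def angle_frac_def poly_roots_finite)
  then have "real (p + 2) \<le> real (root_count ?f 0 0)" using o by simp
  then have "real (p + 2) / real (degree ?f) \<le> real (root_count ?f 0 0) / real (degree ?f)"
    by (intro divide_right_mono) auto
  also have "\<dots> \<le> discrepancy ?f" using discrepancy_ge[OF f, of 0 0] by simp
  finally show ?thesis by (simp add: co)
qed

lemma sqrt_2_sharp:
  assumes "c < sqrt 2"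
  shows "\<exists>f :: complex poly. degree f \<ge> 1 \<and> poly f 0 \<noteq> 0 \<and> discrepancy f > c * sqrt (height f)"
proof -
  \<comment> \<open>A positive constant is needed to compare squares; \<open>c\<close> may be
    negative.\<close>
  define c' where "c' = max c 1"
  have c': "c' < sqrt 2" "c' \<ge> 1" "c \<le> c'" using assms by (auto simp: c'_def)
  have "c'\<^sup>2 < (sqrt 2)\<^sup>2" using c' by (intro power_strict_mono) auto
  then have c2: "c'\<^sup>2 < 2" by simp
  \<comment> \<open>With \<open>m = s^3\<close>, \<open>M = s^4\<close> and
    \<open>n = 2 s^4 + s^3\<close>, \<open>B s\<close> bounds \<open>n\<close> times the height. The
    ratio \<open>(m\<^sup>2 / n) / B s\<close> behaves like
    \<open>(s\<^sup>2 / 2) / (s\<^sup>2 / 4)\<close>, the logarithm being negligible.\<close>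
  define B where "B s = ln (2 + 4 * (2 * s ^ 4 + s ^ 3)) + s\<^sup>2 / 4" for s :: real
  have "((\<lambda>s::real. (s ^ 6 / (2 * s ^ 4 + s ^ 3)) / (ln (2 + 4 * (2 * s ^ 4 + s ^ 3)) + s\<^sup>2 / 4)) \<longlongrightarrow> 2) at_top"
    by real_asymp
  then have "filterlim (\<lambda>s::nat. (real s ^ 6 / (2 * real s ^ 4 + real s ^ 3)) / B (real s)) (nhds 2) sequentially"
    unfolding B_def by (rule filterlim_compose) (rule filterlim_real_sequentially)
  then have "eventually (\<lambda>s::nat. (real s ^ 6 / (2 * real s ^ 4 + real s ^ 3)) / B (real s) > c'\<^sup>2) sequentially"
    using c2 by (rule order_tendstoD(1))
  then have "eventually (\<lambda>s::nat. (real s ^ 6 / (2 * real s ^ 4 + real s ^ 3)) / B (real s) > c'\<^sup>2 \<and> s \<ge> 2) sequentially"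
    using eventually_ge_at_top[of 2] by eventually_elim auto
  then obtain s :: nat where s: "(real s ^ 6 / (2 * real s ^ 4 + real s ^ 3)) / B (real s) > c'\<^sup>2" "s \<ge> 2"
    by (auto simp: eventually_sequentially)
  define p M where "p = s ^ 3 - 2" and "M = s ^ 4"
  define f where "f = extremal_poly p M"
  define n where "n = real (2 * M + p + 2)"
  have "2 ^ 3 \<le> s ^ 3" using s(2) by (rule power_mono) simp
  then have p: "p + 2 = s ^ 3" by (simp add: p_def)
  have M: "M > 0" using s(2) by (simp add: M_def)
  have "n > 0" by (simp add: n_def)
  moreover have "n = 2 * real s ^ 4 + real s ^ 3"
    unfolding n_def add.assoc p by (simp add: M_def)
  ultimately have n: "n = 2 * real s ^ 4 + real s ^ 3" "n > 0" by auto
  have m: "(real (p + 2))\<^sup>2 = real s ^ 6" "(real (p + 2))\<^sup>2 / (4 * real M) = (real s)\<^sup>2 / 4"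
    unfolding p using s(2) by (simp_all add: M_def power_mult[symmetric] field_simps power_add[symmetric])
  have Bpos: "B (real s) > 0"
  proof -
    have "ln (2 + 4 * n) > 0" using n(2) by simp
    then show ?thesis unfolding B_def n(1)[symmetric] by (simp add: add_pos_nonneg)
  qed
  note co = extremal_poly_coeffs[of p M, folded f_def]
  have f: "degree f \<ge> 1" "poly f 0 \<noteq> 0"
    using co multichoose_pos[of "p + 2" "2 * M"] by auto
  have h0: "height f \<ge> 0" by (rule height_nonneg[OF f])
  have "height f \<le> B (real s) / n"
    using height_extremal_poly_le[OF M, of p] unfolding f_def n_def[symmetric] m(2) B_def n(1)[symmetric] .
  then have "c'\<^sup>2 * height f \<le> c'\<^sup>2 * (B (real s) / n)" by (intro mult_left_mono) auto
  also have "\<dots> = c'\<^sup>2 * B (real s) / n" by simp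
  also have "\<dots> < (real s ^ 6 / n) / n"
    using s(1) Bpos n(2) unfolding n(1)[symmetric]
    by (intro divide_strict_right_mono) (simp_all add: pos_less_divide_eq mult_ac)
  also have "\<dots> = (real (p + 2) / n)\<^sup>2" unfolding power_divide m(1) by (simp add: power2_eq_square)
  finally have "(c' * sqrt (height f))\<^sup>2 < (real (p + 2) / n)\<^sup>2"
    using h0 by (simp add: power_mult_distrib)
  then have "c' * sqrt (height f) < real (p + 2) / n"
    by (rule power_less_imp_less_base) (use n(2) in auto)
  also have "\<dots> \<le> discrepancy f" unfolding f_def n_def by (rule discrepancy_extremal_poly_ge)
  finally have "c' * sqrt (height f) < discrepancy f" .
  moreover have "c * sqrt (height f) \<le> c' * sqrt (height f)"
    using c' h0 by (intro mult_right_mono) auto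
  ultimately show ?thesis using f by (intro exI[of _ f]) auto
qed

theorem theorem1p1:
  shows "(\<forall>f :: complex poly. degree f \<ge> 1 \<and> poly f 0 \<noteq> 0 \<longrightarrow>
            discrepancy f \<le> sqrt 2 * sqrt (height f))
       \<and> (\<forall>c :: real. c < sqrt 2 \<longrightarrow>
            (\<exists>f :: complex poly. degree f \<ge> 1 \<and> poly f 0 \<noteq> 0 \<and>
               discrepancy f > c * sqrt (height f)))"
  using discrepancy_le_sqrt_height sqrt_2_sharp by blast

end
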